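(* Let $Z=z_1e_1+z_2e_2$, $\mathcal{V}=\nu_1e_1+\nu_2e_2=\alpha+j\beta$ ($\alpha,\beta\in\mathbb{C}(i)$), $C=c_1e_1+c_2e_2\in\mathbb{BC}$ with $\Re(\alpha)+1>|\Im(\beta)|$, $\Re(c_1z_1)<0$ and $\Re(c_2z_2)<0$, and let $s=s_1e_1+s_2e_2$ denote a bicomplex integration variable. Then $$\int_\Omega\frac{(-C)^sZ^{\mathcal{V}+s}\,\Gamma(-s)\Gamma(1+s)}{\Gamma(\mathcal{V}+1+s)}\,ds=2\pi i\,E_{\mathcal{V},C}(Z),$$ where $\Omega=(\Omega_1,\Omega_2)$ is a path in $\mathbb{BC}$ whose components $\Omega_1$ and $\Omega_2$ are Barnes paths in $\mathbb{C}(i)$ starting at $-i\infty$ and running to $+i\infty$.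
   Context: Bicomplex numbers: $\mathbb{BC}=\{w_1+jw_2: w_1,w_2\in\mathbb{C}(i)\}$, where $\mathbb{C}(i)$ is the complex field with unit $i$, $i^2=j^2=-1$, $ij=ji$. Put $e_1=\frac{1+ij}{2}$, $e_2=\frac{1-ij}{2}$, so $e_1+e_2=1$, $e_l^2=e_l$, $e_1e_2=0$. Every $Z=w_1+jw_2$ is uniquely $Z=z_1e_1+z_2e_2$ with $z_1=w_1-iw_2$, $z_2=w_1+iw_2\in\mathbb{C}(i)$, and addition, multiplication and division are componentwise in $e_1,e_2$; in particular $\nu_1=\alpha-i\beta$, $\nu_2=\alpha+i\beta$. Functions act componentwise: $\Gamma(Y)=\Gamma(y_1)e_1+\Gamma(y_2)e_2$ for $Y=y_1e_1+y_2e_2$ (with $1/\Gamma$ equal to $0$ at the poles of $\Gamma$), and $Z^{W}=z_1^{w_1}e_1+z_2^{w_2}e_2$ for $Z=z_1e_1+z_2e_2$, $W=w_1e_1+w_2e_2$ (principal complex powers). The expression $(-C)^sZ^{\mathcal{V}+s}$ stands for $Z^{\mathcal{V}}(-CZ)^s$, with principal powers $(-c_lz_l)^{s_l}$. Bicomplex Miller-Ross function: $E_{\mathcal{V},C}(Z)=Z^{\mathcal{V}}\sum_{r=0}^{\infty}\frac{(CZ)^r}{\Gamma(\mathcal{V}+r+1)}$ for $\mathcal{V},C,Z\in\mathbb{BC}$. Integration: for a bicomplex path $\Omega=(\Omega_1,\Omega_2)$ with component paths in $\mathbb{C}(i)$, $\int_\Omega f(s)\,ds=\left[\int_{\Omega_1}f_1(s_1)ds_1\right]e_1+\left[\int_{\Omega_2}f_2(s_2)ds_2\right]e_2$,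 where $f=f_1e_1+f_2e_2$ componentwise. A Barnes path (for this integrand) is a path from $-i\infty$ to $+i\infty$ such that the poles $s=0,1,2,\dots$ of $\Gamma(-s)$ lie to its right and the poles $s=-1,-2,\dots$ of $\Gamma(1+s)$ lie to its left (e.g. the vertical line $\Re s=-\tfrac12$). *)

theory Defs
  imports "HOL-Complex_Analysis.Complex_Analysis"
begin

text \<open>\<open>BC w\<^sub>1 w\<^sub>2\<close> is the bicomplex number \<open>w\<^sub>1 + j w\<^sub>2\<close>.\<close>

datatype bicomplex = BC (bc_w1: complex) (bc_w2: complex)

instantiation bicomplex :: comm_ring_1
begin

definition "0 = BC 0 0"
definition "1 = BC 1 0"
definition "x + y = BC (bc_w1 x + bc_w1 y) (bc_w2 x + bc_w2 y)"
definition "x - y = BC (bc_w1 x - bc_w1 y) (bc_w2 x - bc_w2 y)"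
definition "- x = BC (- bc_w1 x) (- bc_w2 x)"
definition "x * y =
  BC (bc_w1 x * bc_w1 y - bc_w2 x * bc_w2 y) (bc_w1 x * bc_w2 y + bc_w2 x * bc_w1 y)"

instance
  by standard
    (auto simp: zero_bicomplex_def one_bicomplex_def plus_bicomplex_def minus_bicomplex_def
      uminus_bicomplex_def times_bicomplex_def algebra_simps)

end

text \<open>The norm is the Euclidean one, \<open>sqrt (\<bar>w\<^sub>1\<bar>\<^sup>2 + \<bar>w\<^sub>2\<bar>\<^sup>2)\<close>. It is not submultiplicative; it
  only serves to give \<open>bicomplex\<close> its topology, in which convergence is componentwise.\<close>

instantiation bicomplex :: real_normed_vector
begin

definition "scaleR r x = BC (scaleR r (bc_w1 x)) (scaleR r (bc_w2 x))"
definition "norm x = norm (bc_w1 x, bc_w2 x)"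
definition "dist x y = norm (x - y :: bicomplex)"
definition "sgn x = scaleR (inverse (norm x)) (x :: bicomplex)"
definition [code del]:
  "(uniformity :: (bicomplex \<times> bicomplex) filter) = (INF e\<in>{0<..}. principal {(x, y). dist x y < e})"
definition [code del]:
  "open (U :: bicomplex set) \<longleftrightarrow> (\<forall>x\<in>U. \<forall>\<^sub>F (x', y) in uniformity. x' = x \<longrightarrow> y \<in> U)"

instance
proof
  fix x y :: bicomplex and a b :: real
  show "a *\<^sub>R (x + y) = a *\<^sub>R x + a *\<^sub>R y" "(a + b) *\<^sub>R x = a *\<^sub>R x + b *\<^sub>R x"
    "a *\<^sub>R b *\<^sub>R x = (a * b) *\<^sub>R x" "1 *\<^sub>R x = x"
    by (simp_all add: scaleR_bicomplex_def plus_bicomplex_def algebra_simps)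
  show "norm x = 0 \<longleftrightarrow> x = 0"
    by (cases x) (auto simp: norm_bicomplex_def zero_bicomplex_def zero_prod_def)
  show "norm (x + y) \<le> norm x + norm y"
    using norm_triangle_ineq[of "(bc_w1 x, bc_w2 x)" "(bc_w1 y, bc_w2 y)"]
    by (simp add: norm_bicomplex_def plus_bicomplex_def)
  show "norm (a *\<^sub>R x) = \<bar>a\<bar> * norm x"
    using norm_scaleR[of a "(bc_w1 x, bc_w2 x)"]
    by (simp add: norm_bicomplex_def scaleR_bicomplex_def)
qed (simp_all add: dist_bicomplex_def sgn_bicomplex_def uniformity_bicomplex_def
      open_bicomplex_def)

end

definition bc_of_complex :: "complex \<Rightarrow> bicomplex"
  where "bc_of_complex w = BC w 0"

definition bc_j :: bicomplex
  where "bc_j = BC 0 1"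

definition bc_e1 :: bicomplex
  where "bc_e1 = (1/2) *\<^sub>R (1 + bc_of_complex \<i> * bc_j)"

definition bc_e2 :: bicomplex
  where "bc_e2 = (1/2) *\<^sub>R (1 - bc_of_complex \<i> * bc_j)"

text \<open>The idempotent components \<open>z\<^sub>1 = w\<^sub>1 - i w\<^sub>2\<close> and \<open>z\<^sub>2 = w\<^sub>1 + i w\<^sub>2\<close>.\<close>

definition idem1 :: "bicomplex \<Rightarrow> complex"
  where "idem1 Z = bc_w1 Z - \<i> * bc_w2 Z"

definition idem2 :: "bicomplex \<Rightarrow> complex"
  where "idem2 Z = bc_w1 Z + \<i> * bc_w2 Z"

definition bc_of_idem :: "complex \<Rightarrow> complex \<Rightarrow> bicomplex"
  where "bc_of_idem z1 z2 = bc_of_complex z1 * bc_e1 + bc_of_complex z2 * bc_e2"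

lemmas bc_defs = zero_bicomplex_def one_bicomplex_def plus_bicomplex_def minus_bicomplex_def
  uminus_bicomplex_def times_bicomplex_def scaleR_bicomplex_def bc_of_complex_def bc_j_def
  bc_e1_def bc_e2_def idem1_def idem2_def bc_of_idem_def

lemma bc_eq_w_decomp: "Z = bc_of_complex (bc_w1 Z) + bc_j * bc_of_complex (bc_w2 Z)"
  by (cases Z) (simp add: bc_defs)

lemma bc_j_squared: "bc_j * bc_j = -1"
  by (simp add: bc_defs)

lemma bc_e_relations:
  "bc_e1 + bc_e2 = 1" "bc_e1 * bc_e1 = bc_e1" "bc_e2 * bc_e2 = bc_e2" "bc_e1 * bc_e2 = 0"
  by (simp_all add: bc_defs complex_eq_iff)

lemma idem_of_idem [simp]: "idem1 (bc_of_idem z1 z2) = z1" "idem2 (bc_of_idem z1 z2) = z2"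
  by (simp_all add: bc_defs complex_eq_iff)

lemma bc_of_idem_idem [simp]: "bc_of_idem (idem1 Z) (idem2 Z) = Z"
  by (cases Z) (simp add: bc_defs complex_eq_iff field_simps)

lemma bc_eq_idem_iff: "Z = W \<longleftrightarrow> idem1 Z = idem1 W \<and> idem2 Z = idem2 W"
  by (metis bc_of_idem_idem)

lemma idem_add: "idem1 (Z + W) = idem1 Z + idem1 W" "idem2 (Z + W) = idem2 Z + idem2 W"
  by (simp_all add: bc_defs algebra_simps)

lemma idem_mult: "idem1 (Z * W) = idem1 Z * idem1 W" "idem2 (Z * W) = idem2 Z * idem2 W"
  by (simp_all add: bc_defs algebra_simps)

text \<open>\<open>bc_rGamma\<close> is the bicomplex \<open>1/\<Gamma>\<close>, with value \<open>0\<close> in each component that is a pole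
  of \<open>\<Gamma>\<close>.\<close>

definition bc_Gamma :: "bicomplex \<Rightarrow> bicomplex"
  where "bc_Gamma Y = bc_of_idem (Gamma (idem1 Y)) (Gamma (idem2 Y))"

definition bc_rGamma :: "bicomplex \<Rightarrow> bicomplex"
  where "bc_rGamma Y = bc_of_idem (rGamma (idem1 Y)) (rGamma (idem2 Y))"

text \<open>Principal powers componentwise; \<open>0 powr w = 0\<close> for every \<open>w\<close>, so the value is conventional
  when \<open>Z\<close> has a vanishing idempotent component.\<close>

definition bc_powr :: "bicomplex \<Rightarrow> bicomplex \<Rightarrow> bicomplex"  (infixr "bc'_powr" 80)
  where "Z bc_powr W = bc_of_idem (idem1 Z powr idem1 W) (idem2 Z powr idem2 W)"

definition miller_ross :: "bicomplex \<Rightarrow> bicomplex \<Rightarrow> bicomplex \<Rightarrow> bicomplex"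
  where "miller_ross V C Z =
    Z bc_powr V * (\<Sum>r. (C * Z) ^ r * bc_rGamma (V + of_nat r + 1))"

text \<open>A path from \<open>-i\<infinity>\<close> to \<open>+i\<infinity>\<close> is a piecewise continuously differentiable curve, parametrised
  by the whole real line, with bounded real part and with imaginary part running from \<open>-\<infinity>\<close> to
  \<open>+\<infinity>\<close>. Because the real part is bounded, the complement of the curve contains a left half-plane
  and a right half-plane; the points to the left (right) of the curve are those in the same
  component of the complement as the former (the latter).\<close>

definition vertical_path :: "(real \<Rightarrow> complex) \<Rightarrow> bool"
  where "vertical_path \<gamma> \<longleftrightarrow>
    (\<forall>a b. \<gamma> piecewise_C1_differentiable_on {a..b}) \<and>
    bounded (range (\<lambda>t. Re (\<gamma> t))) \<and>
    filterlim (\<lambda>t. Im (\<gamma> t)) at_bot at_bot \<and>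
    filterlim (\<lambda>t. Im (\<gamma> t)) at_top at_top"

definition lies_left_of :: "complex \<Rightarrow> (real \<Rightarrow> complex) \<Rightarrow> bool"
  where "lies_left_of p \<gamma> \<longleftrightarrow>
    (\<forall>\<^sub>F x in at_bot. connected_component (- range \<gamma>) p (complex_of_real x))"

definition lies_right_of :: "complex \<Rightarrow> (real \<Rightarrow> complex) \<Rightarrow> bool"
  where "lies_right_of p \<gamma> \<longleftrightarrow>
    (\<forall>\<^sub>F x in at_top. connected_component (- range \<gamma>) p (complex_of_real x))"

definition barnes_path :: "(real \<Rightarrow> complex) \<Rightarrow> bool"
  where "barnes_path \<gamma> \<longleftrightarrow> vertical_path \<gamma> \<and>
    (\<forall>n::nat. lies_right_of (of_nat n) \<gamma>) \<and>
    (\<forall>n::nat. n \<ge> 1 \<longrightarrow> lies_left_of (- of_nat n) \<gamma>)"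

lemma barnes_path_vertical_line: "barnes_path (\<lambda>t. Complex (-1/2) t)"
proof -
  let ?g = "\<lambda>t. Complex (-1/2) t"
  have g: "?g = (\<lambda>t. of_real (-1/2) + \<i> * of_real t)"
    by (auto simp: complex_eq_iff)
  have "?g C1_differentiable_on S" for S
    unfolding g C1_differentiable_on_def
    by (rule exI[of _ "\<lambda>_. \<i>"]) (auto intro!: derivative_eq_intros)
  then have pw: "?g piecewise_C1_differentiable_on {a..b}" for a b
    by (simp add: C1_differentiable_imp_piecewise)
  have conv: "connected {z. Re z > -1/2}" "connected {z. Re z < -1/2}"
    by (auto intro!: convex_connected convex_halfspace_Re_gt convex_halfspace_Re_lt)
  have r: "lies_right_of (of_nat n) ?g" for n
    unfolding lies_right_of_def connected_component_def
    by (rule eventually_mono[OF eventually_ge_at_top[of 0]])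
      (rule exI[of _ "{z. Re z > -1/2}"], use conv in auto)
  have l: "lies_left_of (- of_nat n) ?g" if "n \<ge> 1" for n
    unfolding lies_left_of_def connected_component_def
    by (rule eventually_mono[OF eventually_le_at_bot[of "-1"]])
      (rule exI[of _ "{z. Re z < -1/2}"], use conv that in auto)
  show ?thesis
    unfolding barnes_path_def vertical_path_def
    using pw r l by (auto simp: filterlim_ident)
qed

text \<open>The integral along an unbounded curve is the improper integral, both ends of the parameter
  interval tending to infinity independently.\<close>

definition has_improper_contour_integral ::
    "(complex \<Rightarrow> complex) \<Rightarrow> complex \<Rightarrow> (real \<Rightarrow> complex) \<Rightarrow> bool"
  where "has_improper_contour_integral f I \<gamma> \<longleftrightarrow>
    (\<forall>a b. f contour_integrable_on subpath a b \<gamma>) \<and>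
    ((\<lambda>(a, b). contour_integral (subpath a b \<gamma>) f) \<longlongrightarrow> I) (at_bot \<times>\<^sub>F at_top)"

text \<open>The bicomplex integral is defined for functions that act componentwise,
  \<open>f (s\<^sub>1e\<^sub>1 + s\<^sub>2e\<^sub>2) = f\<^sub>1(s\<^sub>1)e\<^sub>1 + f\<^sub>2(s\<^sub>2)e\<^sub>2\<close>; \<open>f\<^sub>1\<close> and \<open>f\<^sub>2\<close> are then determined by \<open>f\<close>.\<close>

definition has_bc_contour_integral ::
    "(bicomplex \<Rightarrow> bicomplex) \<Rightarrow> bicomplex \<Rightarrow> (real \<Rightarrow> bicomplex) \<Rightarrow> bool"
  where "has_bc_contour_integral f I \<Omega> \<longleftrightarrow>
    (\<exists>f1 f2 I1 I2. (\<forall>s1 s2. f (bc_of_idem s1 s2) = bc_of_idem (f1 s1) (f2 s2)) \<and>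
      has_improper_contour_integral f1 I1 (\<lambda>t. idem1 (\<Omega> t)) \<and>
      has_improper_contour_integral f2 I2 (\<lambda>t. idem2 (\<Omega> t)) \<and>
      I = bc_of_idem I1 I2)"

end

theory Submission
  imports Defs "HOL-Real_Asymp.Real_Asymp"
begin

text \<open>Everything is componentwise, so let \<open>x = - c z\<close> with \<open>Re x > 0\<close> be one component. By reflection
  \<open>\<Gamma>(-s) \<Gamma>(1+s) = - \<pi> / sin \<pi>s\<close>, so the integrand has simple poles at most at the integers. Close
  the part of the Barnes path between two parameters to the right along \<open>Re s = N + 1/2\<close>: the
  points \<open>-1, -2, \<dots>\<close> have winding number \<open>0\<close> and \<open>0, \<dots>, N\<close> have winding number \<open>-1\<close>, and the
  residues at the latter give the partial sums of the Miller-Ross series. The error is controlled by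
  \<open>\<bar>1/\<Gamma>(\<sigma> + i t)\<bar> \<le> exp (\<pi>\<bar>t\<bar>/2) / \<Gamma>(\<sigma>)\<close> for \<open>\<sigma> \<ge> 1/2\<close>, against which \<open>1 / sin \<pi>s\<close> gains
  \<open>exp (- \<pi>\<bar>t\<bar>)\<close> and \<open>x\<^sup>s\<close> loses only \<open>exp (\<bar>arg x\<bar> \<bar>t\<bar>)\<close> with \<open>\<bar>arg x\<bar> < \<pi>/2\<close>.\<close>

subsection \<open>Growth of the reciprocal Gamma function\<close>

text \<open>Factor by factor: |b + k + it| / (b + k) is the square root of 1 + t^2 / (b + k)^2,
  which decreases as b grows. The inequality is cross-multiplied so that it passes to products and
  limits without quotients.\<close>

lemma norm_pochhammer_ratio_antimono:
  fixes a b t :: real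
  assumes "0 < a" "a \<le> b"
  shows "norm (pochhammer (Complex b t) n) * pochhammer a n
    \<le> pochhammer b n * norm (pochhammer (Complex a t) n)"
proof -
  have factor: "norm (Complex b t + of_nat k) * (a + real k) \<le> (b + real k) * norm (Complex a t + of_nat k)" for k
  proof (rule power2_le_imp_le)
    have "t\<^sup>2 * (a + real k)\<^sup>2 \<le> t\<^sup>2 * (b + real k)\<^sup>2"
      using assms by (intro mult_left_mono power_mono) auto
    then show "(norm (Complex b t + of_nat k) * (a + real k))\<^sup>2 \<le> ((b + real k) * norm (Complex a t + of_nat k))\<^sup>2"
      unfolding power_mult_distrib cmod_power2 by (simp add: algebra_simps)
  qed (use assms in auto)
  have "norm (pochhammer (Complex b t) n) * pochhammer a n
      = (\<Prod>k<n. norm (Complex b t + of_nat k) * (a + real k))"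
    by (simp add: pochhammer_prod prod_norm prod.distrib atLeast0LessThan)
  also have "\<dots> \<le> (\<Prod>k<n. (b + real k) * norm (Complex a t + of_nat k))"
    using factor assms by (intro prod_mono) auto
  also have "\<dots> = pochhammer b n * norm (pochhammer (Complex a t) n)"
    by (simp add: pochhammer_prod prod_norm prod.distrib atLeast0LessThan)
  finally show ?thesis .
qed

text \<open>The previous estimate, term by term in Euler's limit for \<open>1/\<Gamma>\<close>.\<close>

lemma norm_rGamma_ratio_antimono:
  fixes a b t :: real
  assumes "0 < a" "a \<le> b"
  shows "norm (rGamma (Complex b t)) * rGamma a \<le> rGamma b * norm (rGamma (Complex a t))"
proof (rule LIMSEQ_le)
  show "(\<lambda>n. norm (rGamma_series (Complex b t) n) * rGamma_series a n)
      \<longlonglongrightarrow> norm (rGamma (Complex b t)) * rGamma a"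
    by (intro tendsto_intros)
  show "(\<lambda>n. rGamma_series b n * norm (rGamma_series (Complex a t) n))
      \<longlonglongrightarrow> rGamma b * norm (rGamma (Complex a t))"
    by (intro tendsto_intros)
  show "\<exists>N. \<forall>n\<ge>N. norm (rGamma_series (Complex b t) n) * rGamma_series a n
      \<le> rGamma_series b n * norm (rGamma_series (Complex a t) n)"
  proof (intro exI allI impI)
    fix n :: nat
    \<comment> \<open>Since n^(b + it) has modulus n^b, both sides of the inequality carry the same
      denominator in Euler's product, and only the Pochhammer symbols remain to be compared.\<close>
    let ?D = "fact n * exp (b * ln (real n)) * (fact n * exp (a * ln (real n)))"
    have "norm (rGamma_series (Complex b t) n) * rGamma_series a n
        = (norm (pochhammer (Complex b t) (n+1)) * pochhammer a (n+1)) / ?D"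
      by (simp add: rGamma_series_def norm_mult norm_divide)
    also have "\<dots> \<le> (pochhammer b (n+1) * norm (pochhammer (Complex a t) (n+1))) / ?D"
      by (intro divide_right_mono norm_pochhammer_ratio_antimono assms) auto
    also have "\<dots> = rGamma_series b n * norm (rGamma_series (Complex a t) n)"
      by (simp add: rGamma_series_def norm_mult norm_divide)
    finally show "norm (rGamma_series (Complex b t) n) * rGamma_series a n
      \<le> rGamma_series b n * norm (rGamma_series (Complex a t) n)" .
  qed
qed

text \<open>With e = exp (2 |Im z|), the square of |sin z| is at most (e + 1 + 2) / 4, because the
  smaller exponential is at most 1 and the cosine at least -1; this is at most e because e is at
  least 1.\<close>

lemma norm_sin_le: "norm (sin z) \<le> exp \<bar>Im z\<bar>" for z :: complex
proof (rule power2_le_imp_le)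
  let ?e = "exp (2 * \<bar>Im z\<bar>)"
  have "exp (2 * Im z) + inverse (exp (2 * Im z)) \<le> ?e + 1"
    by (cases "Im z \<ge> 0") (auto simp flip: exp_minus)
  moreover have "1 \<le> ?e" by simp
  moreover have "cos (2 * Re z) \<ge> -1" by simp
  moreover have "(a + b - 2 * c) / 4 \<le> e" if "a + b \<le> e + 1" "1 \<le> e" "-1 \<le> c" for a b c e :: real
    using that by (simp add: field_simps)
  ultimately have "(norm (sin z))\<^sup>2 \<le> ?e"
    unfolding norm_sin_squared by blast
  then show "(norm (sin z))\<^sup>2 \<le> (exp \<bar>Im z\<bar>)\<^sup>2"
    by (simp add: exp_double)
qed simp

text \<open>On the line \<open>Re s = 1/2\<close> reflection pairs \<open>s\<close> with its conjugate.\<close>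

lemma norm_rGamma_half_le: "norm (rGamma (Complex (1/2) t)) \<le> exp (pi * \<bar>t\<bar> / 2) * rGamma (1/2)"
proof (rule power2_le_imp_le)
  let ?z = "Complex (1/2) t"
  have c: "1 - ?z = cnj ?z" by (simp add: complex_eq_iff)
  have "complex_of_real ((norm (rGamma ?z))\<^sup>2) = rGamma ?z * cnj (rGamma ?z)"
    by (simp add: complex_norm_square del: of_real_power)
  also have "\<dots> = rGamma ?z * rGamma (1 - ?z)"
    unfolding c by (simp add: cnj_rGamma)
  also have "\<dots> = sin (of_real pi * ?z) / of_real pi"
    by (rule rGamma_reflection_complex)
  finally have e: "complex_of_real ((norm (rGamma ?z))\<^sup>2) = sin (of_real pi * ?z) / of_real pi" .
  have "(norm (rGamma ?z))\<^sup>2 = norm (complex_of_real ((norm (rGamma ?z))\<^sup>2))"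
    by (simp only: norm_of_real abs_power2)
  also have "\<dots> = norm (sin (of_real pi * ?z)) / pi"
    unfolding e by (simp add: norm_divide)
  finally have e2: "(norm (rGamma ?z))\<^sup>2 = norm (sin (of_real pi * ?z)) / pi" .
  have "norm (sin (of_real pi * ?z)) \<le> exp (pi * \<bar>t\<bar>)"
    using norm_sin_le[of "of_real pi * ?z"] by (simp add: abs_mult)
  then have "(norm (rGamma ?z))\<^sup>2 \<le> exp (pi * \<bar>t\<bar>) / pi"
    unfolding e2 by (simp add: divide_right_mono)
  \<comment> \<open>Here \<open>rGamma (1/2)\<close> is 1 / sqrt pi, which absorbs the factor 1 / pi
    after squaring.\<close>
  also have "\<dots> = (exp (pi * \<bar>t\<bar> / 2) * rGamma (1/2))\<^sup>2"
    by (simp add: rGamma_inverse_Gamma Gamma_one_half_real power_mult_distrib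
        flip: exp_double) (simp add: power_inverse field_simps)
  finally show "(norm (rGamma ?z))\<^sup>2 \<le> (exp (pi * \<bar>t\<bar> / 2) * rGamma (1/2))\<^sup>2" .
qed (simp add: rGamma_inverse_Gamma)

lemma rGamma_real_pos: "x > 0 \<Longrightarrow> rGamma (x::real) > 0"
  by (simp add: rGamma_inverse_Gamma)

text \<open>The ratio estimate moves w horizontally to the line Re = 1/2, where the growth in Im w
  is known. The growth in Im w is thus separated from \<open>rGamma (Re w)\<close>, whose decay
  beats every power |x|^N on lines far to the right.\<close>

lemma norm_rGamma_le:
  assumes "Re w \<ge> 1/2"
  shows "norm (rGamma w) \<le> rGamma (Re w) * exp (pi * \<bar>Im w\<bar> / 2)"
proof -
  have "norm (rGamma w) * rGamma (1/2) \<le> rGamma (Re w) * norm (rGamma (Complex (1/2) (Im w)))"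
    using norm_rGamma_ratio_antimono[of "1/2" "Re w" "Im w"] assms by simp
  also have "\<dots> \<le> rGamma (Re w) * (exp (pi * \<bar>Im w\<bar> / 2) * rGamma (1/2))"
    using assms rGamma_real_pos[of "Re w"] by (intro mult_left_mono norm_rGamma_half_le) auto
  finally have "norm (rGamma w) * rGamma (1/2) \<le> (rGamma (Re w) * exp (pi * \<bar>Im w\<bar> / 2)) * rGamma (1/2)"
    by (simp add: mult_ac)
  then show ?thesis
    using rGamma_real_pos[of "1/2"] by (simp add: mult_le_cancel_right)
qed

text \<open>Left of Re = 1/2 the functional equation shifts w by K to the right; the price is a
  Pochhammer symbol, polynomial of degree K in |Im w|. The exponential rate pi/2 stays the
  same.\<close>

lemma norm_rGamma_strip_le:
  "\<exists>B K. \<forall>w. \<bar>Re w\<bar> \<le> M \<longrightarrow> norm (rGamma w) \<le> B * (1 + \<bar>Im w\<bar>) ^ K * exp (pi * \<bar>Im w\<bar> / 2)"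
proof -
  \<comment> \<open>As Re w is at least -M, the shifted point w + K has real part at least
    1/2.\<close>
  obtain K :: nat where K: "real K \<ge> M + 1/2" using real_arch_simple by blast
  have "compact (rGamma ` {1/2..M + real K})"
    by (intro compact_continuous_image continuous_intros) auto
  then obtain D where D: "\<And>x. x \<in> {1/2..M + real K} \<Longrightarrow> norm (rGamma x) \<le> D"
    unfolding bounded_iff by (metis bounded_iff compact_imp_bounded imageI)
  define B where "B = (1 + \<bar>M\<bar> + real K) ^ K * \<bar>D\<bar>"
  show ?thesis
  proof (intro exI allI impI)
    fix w assume w: "\<bar>Re w\<bar> \<le> M"
    have f: "norm (w + of_nat k) \<le> (1 + \<bar>M\<bar> + real K) * (1 + \<bar>Im w\<bar>)" if "k < K" for k
    proof -
      have "norm (w + of_nat k) \<le> \<bar>Re w\<bar> + \<bar>Im w\<bar> + real k"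
        using norm_triangle_ineq[of w "of_nat k"] cmod_le[of w] by simp
      also have "\<dots> \<le> (1 + \<bar>M\<bar> + real K) + \<bar>Im w\<bar> * (1 + \<bar>M\<bar> + real K)"
        using w that mult_nonneg_nonneg[of "\<bar>Im w\<bar>" "\<bar>M\<bar> + real K"]
        unfolding distrib_left by linarith
      finally show ?thesis by (simp add: algebra_simps)
    qed
    have "norm (pochhammer w K) = (\<Prod>k<K. norm (w + of_nat k))"
      by (simp add: pochhammer_prod prod_norm atLeast0LessThan)
    also have "\<dots> \<le> (\<Prod>k<K. (1 + \<bar>M\<bar> + real K) * (1 + \<bar>Im w\<bar>))"
      using f by (intro prod_mono) auto
    also have "\<dots> = ((1 + \<bar>M\<bar> + real K) * (1 + \<bar>Im w\<bar>)) ^ K" by simp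
    finally have p: "norm (pochhammer w K) \<le> ((1 + \<bar>M\<bar> + real K) * (1 + \<bar>Im w\<bar>)) ^ K" .
    have "norm (rGamma (w + of_nat K)) \<le> rGamma (Re w + real K) * exp (pi * \<bar>Im w\<bar> / 2)"
      using norm_rGamma_le[of "w + of_nat K"] K w by auto
    also have "\<dots> \<le> \<bar>D\<bar> * exp (pi * \<bar>Im w\<bar> / 2)"
      using D[of "Re w + real K"] K w by (intro mult_right_mono) (auto simp: abs_le_iff)
    finally have q: "norm (rGamma (w + of_nat K)) \<le> \<bar>D\<bar> * exp (pi * \<bar>Im w\<bar> / 2)" .
    have "norm (rGamma w) = norm (pochhammer w K) * norm (rGamma (w + of_nat K))"
      by (subst pochhammer_rGamma[of w K]) (simp add: norm_mult)
    also have "\<dots> \<le> ((1 + \<bar>M\<bar> + real K) * (1 + \<bar>Im w\<bar>)) ^ K * (\<bar>D\<bar> * exp (pi * \<bar>Im w\<bar> / 2))"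
      by (intro mult_mono p q) auto
    finally show "norm (rGamma w) \<le> B * (1 + \<bar>Im w\<bar>) ^ K * exp (pi * \<bar>Im w\<bar> / 2)"
      by (simp add: B_def power_mult_distrib mult_ac)
  qed
qed

text \<open>Ratio test: consecutive terms differ by the factor |x| / |w + n|, which is at most 1/2
  once n exceeds 2 |x| + |w|. It serves twice: for the convergence of the Miller-Ross series, and,
  because its terms tend to 0, for the error on the lines Re s = N + 1/2.\<close>

lemma summable_norm_power_rGamma:
  fixes x w :: complex
  shows "summable (\<lambda>r. norm (x ^ r * rGamma (w + of_nat r)))"
proof -
  obtain N :: nat where N: "real N \<ge> 2 * norm x + norm w + 1" using real_arch_simple by blast
  show ?thesis
  proof (rule summable_ratio_test[of "1/2" N])
    fix n assume n: "n \<ge> N"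
    have "real n \<le> norm (w + of_nat n) + norm w"
      using norm_triangle_ineq4[of "w + of_nat n" w] by simp
    then have b: "2 * norm x \<le> norm (w + of_nat n)" using n N by linarith
    have "2 * (norm x * norm (rGamma (w + of_nat (Suc n)))) \<le> norm (w + of_nat n) * norm (rGamma (w + of_nat (Suc n)))"
      using mult_right_mono[OF b, of "norm (rGamma (w + of_nat (Suc n)))"] by (simp add: mult_ac)
    also have "\<dots> = norm (rGamma (w + of_nat n))"
      using arg_cong[OF rGamma_plus1[of "w + of_nat n"], of norm] by (simp add: norm_mult add_ac)
    finally have *: "norm x * norm (rGamma (w + of_nat (Suc n))) \<le> norm (rGamma (w + of_nat n)) / 2"
      by linarith
    have "norm (norm (x ^ Suc n * rGamma (w + of_nat (Suc n))))
        = norm x ^ n * (norm x * norm (rGamma (w + of_nat (Suc n))))"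
      by (simp add: norm_mult norm_power mult_ac)
    also have "\<dots> \<le> norm x ^ n * (norm (rGamma (w + of_nat n)) / 2)"
      by (intro mult_left_mono *) auto
    finally show "norm (norm (x ^ Suc n * rGamma (w + of_nat (Suc n))))
        \<le> 1/2 * norm (norm (x ^ n * rGamma (w + of_nat n)))"
      by (simp add: norm_mult norm_power mult_ac)
  qed simp
qed

text \<open>Both alternatives keep z away from the zeros of sin: the first is used on horizontal
  sides at large height, the second on the whole vertical line through a half-integer, including its
  crossing of the real axis.\<close>

lemma norm_sin_ge:
  assumes "\<bar>Im z\<bar> \<ge> 1 \<or> cos (2 * Re z) \<le> 0"
  shows "norm (sin z) \<ge> exp \<bar>Im z\<bar> / 4"
proof (rule power2_le_imp_le)
  let ?e = "exp (2 * \<bar>Im z\<bar>)"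
  have e: "?e \<le> exp (2 * Im z) + inverse (exp (2 * Im z))"
    by (cases "Im z \<ge> 0") (auto simp: exp_minus)
  \<comment> \<open>This is the claim e / 16 <= (e - 2 cos) / 4 multiplied out. If the cosine is
    positive, then |Im z| >= 1 and the quadratic Taylor bound gives e >= 5, more than
    enough.\<close>
  have "?e / 4 + 2 * cos (2 * Re z) \<le> ?e"
  proof (cases "cos (2 * Re z) \<le> 0")
    case False
    then have "1 + 2 * \<bar>Im z\<bar> + (2 * \<bar>Im z\<bar>)\<^sup>2 / 2 \<le> ?e" 
      using assms by (intro exp_lower_Taylor_quadratic) auto
    moreover have "(2 * \<bar>Im z\<bar>)\<^sup>2 \<ge> 4"
      using power_mono[of 2 "2 * \<bar>Im z\<bar>" 2] assms False by simp
    moreover have "\<bar>Im z\<bar> \<ge> 1" "cos (2 * Re z) \<le> 1"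
      using assms False by simp_all
    ultimately show ?thesis by linarith
  qed (use exp_gt_zero[of "2 * \<bar>Im z\<bar>"] in linarith)
  moreover have "(exp \<bar>Im z\<bar> / 4)\<^sup>2 = ?e / 16"
    by (simp add: power_divide exp_double)
  ultimately show "(exp \<bar>Im z\<bar> / 4)\<^sup>2 \<le> (norm (sin z))\<^sup>2"
    unfolding norm_sin_squared using e by simp
qed simp

subsection \<open>Winding numbers of closed-up vertical paths\<close>

lemma valid_path_subpath_vertical:
  assumes "vertical_path \<gamma>"
  shows "valid_path (subpath a b \<gamma>)"
proof -
  have "(\<lambda>x. (b - a) * x + a) ` {0..1} = closed_segment a b"
    by (simp add: closed_segment_real_eq)
  then have "\<gamma> piecewise_C1_differentiable_on (\<lambda>x. (b - a) * x + a) ` {0..1}"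
    using assms by (auto simp: vertical_path_def closed_segment_eq_real_ivl)
  from piecewise_C1_differentiable_affine[OF this] show ?thesis
    by (simp add: valid_path_def subpath_def o_def)
qed

lemma path_image_subpath_le_range: "path_image (subpath a b \<gamma>) \<subseteq> range \<gamma>"
  for \<gamma> :: "real \<Rightarrow> complex"
  by (auto simp: path_image_subpath_gen)

text \<open>The parameter line is not compact, but near p only a compact piece of it matters, since
  both ends leave the strip |Im z - Im p| < 1. The complement is therefore open, so its components
  are path components.\<close>

lemma closed_range_vertical_path:
  assumes "vertical_path \<gamma>"
  shows "closed (range \<gamma>)"
  unfolding closed_limpt
proof (intro allI impI)
  fix p assume "p islimpt range \<gamma>"
  then have lim: "p \<in> closure (range \<gamma>)" by (simp add: closure_def)
  have "\<forall>\<^sub>F t in at_bot. Im (\<gamma> t) \<le> Im p - 1" "\<forall>\<^sub>F t in at_top. Im (\<gamma> t) \<ge> Im p + 1"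
    using assms by (auto simp: vertical_path_def filterlim_at_bot filterlim_at_top)
  then obtain A B where AB: "\<And>t. t \<le> A \<Longrightarrow> Im (\<gamma> t) \<le> Im p - 1" "\<And>t. t \<ge> B \<Longrightarrow> Im (\<gamma> t) \<ge> Im p + 1"
    by (auto simp: eventually_at_bot_linorder eventually_at_top_linorder)
  let ?F = "{z. Im z \<le> Im p - 1} \<union> {z. Im z \<ge> Im p + 1}"
  have "continuous_on {A..B} \<gamma>"
    using assms by (auto simp: vertical_path_def piecewise_C1_differentiable_on_def)
  then have cl: "closed (\<gamma> ` {A..B} \<union> ?F)"
    by (intro closed_Un compact_imp_closed compact_continuous_image
        closed_halfspace_Im_le closed_halfspace_Im_ge) auto
  have "range \<gamma> \<subseteq> \<gamma> ` {A..B} \<union> ?F"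
  proof
    fix z assume "z \<in> range \<gamma>"
    then obtain t where "z = \<gamma> t" by auto
    then show "z \<in> \<gamma> ` {A..B} \<union> ?F"
      using AB[of t] by (cases "t \<le> A"; cases "t \<ge> B") auto
  qed
  then have "p \<in> \<gamma> ` {A..B} \<union> ?F"
    using lim cl closure_minimal by blast
  then show "p \<in> range \<gamma>" by auto
qed

text \<open>Leads from the upper end \<open>q\<close> of an upward curve back to its lower end \<open>p\<close>, along \<open>Re s = c\<close>.\<close>

definition closing_path :: "real \<Rightarrow> complex \<Rightarrow> complex \<Rightarrow> real \<Rightarrow> complex"
  where "closing_path c p q = linepath q (Complex c (Im q)) +++
    linepath (Complex c (Im q)) (Complex c (Im p)) +++ linepath (Complex c (Im p)) p"

lemma closing_path_simps [simp]:
  "valid_path (closing_path c p q)" "path (closing_path c p q)"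
  "pathstart (closing_path c p q) = q" "pathfinish (closing_path c p q) = p"
  by (simp_all add: closing_path_def)

lemma path_image_closing_path:
  "path_image (closing_path c p q) =
    {z. Im z = Im q \<and> Re z \<in> closed_segment (Re q) c} \<union>
    {z. Re z = c \<and> Im z \<in> closed_segment (Im p) (Im q)} \<union>
    {z. Im z = Im p \<and> Re z \<in> closed_segment (Re p) c}"
  by (auto simp: closing_path_def path_image_join closed_segment_same_Re closed_segment_same_Im
      closed_segment_commute)

lemma winding_number_linepath_swap:
  "z \<notin> closed_segment a b \<Longrightarrow> winding_number (linepath b a) z = - winding_number (linepath a b) z"
  using winding_number_reversepath[of "linepath a b" z] by simp

text \<open>Following the right closing and then the left one backwards traverses the boundary of
  the rectangle between Re = l and Re = r once clockwise, and z lies inside.\<close>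

lemma winding_number_closing_path_diff:
  assumes "Im p < Im z" "Im z < Im q" "l < Re z" "Re z < r"
    and "Re p \<in> {l..r}" "Re q \<in> {l..r}"
  shows "winding_number (closing_path r p q) z = winding_number (closing_path l p q) z - 1"
proof -
  let ?w = "\<lambda>a b. winding_number (linepath a b) z"
  define pl pr ql qr where defs: "pl = Complex l (Im p)" "pr = Complex r (Im p)"
    "ql = Complex l (Im q)" "qr = Complex r (Im q)"
  have im: "z \<notin> closed_segment x y" if "Im x = Im y" "Im x \<noteq> Im z" for x y
    using that by (auto simp: closed_segment_same_Im)
  have re: "z \<notin> closed_segment x y" if "Re x = Re y" "Re x \<noteq> Re z" for x y
    using that by (auto simp: closed_segment_same_Re)
  \<comment> \<open>The points p and q lie on the horizontal sides of the rectangle and cut each of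
    them in two.\<close>
  have split: "?w pl pr = ?w pl p + ?w p pr" "?w qr ql = ?w qr q + ?w q ql"
    using assms
    by (intro winding_number_split_linepath im;
        simp add: defs closed_segment_same_Im closed_segment_eq_real_ivl)+
  have cr: "winding_number (closing_path r p q) z = ?w q qr + ?w qr pr + ?w pr p"
    and cl: "winding_number (closing_path l p q) z = ?w q ql + ?w ql pl + ?w pl p"
    unfolding closing_path_def defs[symmetric]
    using assms
    by ((subst winding_number_join; (intro im re)?; simp add: defs path_image_join not_in_path_image_join im re)+)
  have "z \<in> box pl qr" using assms by (simp add: defs in_box_complex_iff)
  then have "1 = winding_number (rectpath pl qr) z" by (simp add: winding_number_rectpath)
  also have "\<dots> = ?w pl pr + ?w pr qr + ?w qr ql + ?w ql pl"
    unfolding rectpath_def Let_def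
    using assms
    by (simp add: defs winding_number_join path_image_join im re)
  finally have "1 = ?w pl p + ?w p pr + ?w pr qr + (?w qr q + ?w q ql) + ?w ql pl"
    unfolding split .
  moreover have "?w pr p = - ?w p pr" "?w q qr = - ?w qr q" "?w qr pr = - ?w pr qr"
    using assms by (intro winding_number_linepath_swap im re; simp add: defs)+
  ultimately show ?thesis
    unfolding cr cl by (simp add: algebra_simps)
qed

text \<open>The curve is closed on the side opposite to x, which is what c x < 0 says. The winding
  number is constant along a path from p to x that misses the closed curve, and it vanishes at x
  because the closed curve lies in a half-plane without x.\<close>

lemma winding_number_closed_vertical_eq_0:
  assumes \<gamma>: "vertical_path \<gamma>" and L: "\<And>t. \<bar>Re (\<gamma> t)\<bar> \<le> L"
    and comp: "connected_component (- range \<gamma>) p (complex_of_real x)" and x: "\<bar>x\<bar> > L"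
  shows "\<exists>T R. \<forall>a b c. Im (\<gamma> a) < -T \<longrightarrow> Im (\<gamma> b) > T \<longrightarrow> \<bar>c\<bar> > R \<longrightarrow> c * x < 0 \<longrightarrow>
    winding_number (subpath a b \<gamma> +++ closing_path c (\<gamma> a) (\<gamma> b)) p = 0"
proof -
  have "path_component (- range \<gamma>) p (complex_of_real x)"
    using comp closed_range_vertical_path[OF \<gamma>]
    by (simp add: open_path_connected_component open_Compl)
  then obtain g where g: "path g" "path_image g \<subseteq> - range \<gamma>" "pathstart g = p" "pathfinish g = complex_of_real x"
    by (auto simp: path_component_def)
  have "bounded (path_image g)" by (simp add: g bounded_path_image)
  \<comment> \<open>This one bound serves as both witnesses: the horizontal sides lie at heights
    beyond \<open>T\<close> and the vertical side at distance beyond \<open>T\<close>, so the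
    connecting path meets none of them.\<close>
  then obtain T where T: "\<And>z. z \<in> path_image g \<Longrightarrow> norm z \<le> T"
    by (auto simp: bounded_iff)
  have L0: "L \<ge> 0" using L[of 0] by linarith
  show ?thesis
  proof (intro exI allI impI)
    fix a b c assume a: "Im (\<gamma> a) < -T" and b: "Im (\<gamma> b) > T" and c: "\<bar>c\<bar> > T" "c * x < 0"
    let ?g = "subpath a b \<gamma> +++ closing_path c (\<gamma> a) (\<gamma> b)"
    have p: "path ?g" "pathfinish ?g = pathstart ?g"
      by (simp_all add: valid_path_subpath_vertical[OF \<gamma>] valid_path_imp_path)
    have im: "path_image ?g \<subseteq> range \<gamma> \<union> path_image (closing_path c (\<gamma> a) (\<gamma> b))"
      using path_image_subpath_le_range[of a b \<gamma>] by (auto simp: path_image_join)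
    have "z \<notin> path_image (closing_path c (\<gamma> a) (\<gamma> b))" if "z \<in> path_image g" for z
      using T[OF that] a b c abs_Re_le_cmod[of z] abs_Im_le_cmod[of z]
      by (auto simp: path_image_closing_path)
    then have disj: "path_image g \<inter> path_image ?g = {}"
      using im g(2) by blast
    have "winding_number ?g p = winding_number ?g (complex_of_real x)"
      using disj g pathstart_in_path_image[of g] pathfinish_in_path_image[of g]
      by (intro winding_number_eq[OF p]) (auto simp: connected_path_image)
    also have "\<dots> = 0"
    proof (cases "x > 0")
      case True
      then have "c < 0" using c by (simp add: mult_less_0_iff)
      have "Re z < x" if z: "z \<in> path_image ?g" for z
      proof -
        consider t where "z = \<gamma> t" | "z \<in> path_image (closing_path c (\<gamma> a) (\<gamma> b))"
          using z im by auto
        then show ?thesis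
        proof cases
          case 1
          then show ?thesis using L[of t] x True by auto
        next
          case 2
          then show ?thesis using L[of a] L[of b] \<open>c < 0\<close> True x L0
            by (auto simp: path_image_closing_path closed_segment_eq_real_ivl split: if_splits)
        qed
      qed
      then show ?thesis
        by (intro winding_number_zero_outside[OF p(1) convex_halfspace_Re_lt[of x] p(2)]) auto
    next
      case False
      then have "c > 0" "x < 0" using c by (auto simp: mult_less_0_iff)
      have "Re z > x" if z: "z \<in> path_image ?g" for z
      proof -
        consider t where "z = \<gamma> t" | "z \<in> path_image (closing_path c (\<gamma> a) (\<gamma> b))"
          using z im by auto
        then show ?thesis
        proof cases
          case 1
          then show ?thesis using L[of t] x \<open>x < 0\<close> by auto
        next
          case 2
          then show ?thesis using L[of a] L[of b] \<open>c > 0\<close> \<open>x < 0\<close> x L0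
            by (auto simp: path_image_closing_path closed_segment_eq_real_ivl split: if_splits)
        qed
      qed
      then show ?thesis
        by (intro winding_number_zero_outside[OF p(1) convex_halfspace_Re_gt[of x] p(2)]) auto
    qed
    finally show "winding_number ?g p = 0" .
  qed
qed

lemma eventually_vertical_path_ends:
  assumes "vertical_path \<gamma>"
  shows "\<forall>\<^sub>F (a, b) in at_bot \<times>\<^sub>F at_top. Im (\<gamma> a) < -T \<and> Im (\<gamma> b) > T"
proof -
  have "\<forall>\<^sub>F a in at_bot. Im (\<gamma> a) < -T" "\<forall>\<^sub>F b in at_top. Im (\<gamma> b) > T"
    using assms by (auto simp: vertical_path_def filterlim_at_bot_dense filterlim_at_top_dense)
  from eventually_prodI[OF this] show ?thesis by (simp add: case_prod_unfold)
qed

text \<open>The closing line must be far enough to the right not only of the curve: the connection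
  of p to the far left may make an excursion to the right, and \<open>R\<close> has to exceed that
  too.\<close>

lemma lies_left_of_winding_number:
  assumes \<gamma>: "vertical_path \<gamma>" and p: "lies_left_of p \<gamma>"
  shows "\<exists>R. \<forall>c>R. \<forall>\<^sub>F (a, b) in at_bot \<times>\<^sub>F at_top.
    winding_number (subpath a b \<gamma> +++ closing_path c (\<gamma> a) (\<gamma> b)) p = 0"
proof -
  obtain L where L: "\<And>t. \<bar>Re (\<gamma> t)\<bar> \<le> L"
    using \<gamma> by (auto simp: vertical_path_def bounded_iff)
  have "\<forall>\<^sub>F x in at_bot. connected_component (- range \<gamma>) p (complex_of_real x) \<and> x < - \<bar>L\<bar>"
    using p eventually_gt_at_bot unfolding lies_left_of_def by (intro eventually_conj) auto
  then obtain x where x: "connected_component (- range \<gamma>) p (complex_of_real x)" "x < - \<bar>L\<bar>"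
    using eventually_happens'[OF trivial_limit_at_bot_linorder] by blast
  then have "\<bar>x\<bar> > L" by linarith
  from winding_number_closed_vertical_eq_0[OF \<gamma> L x(1) this] obtain T R where
    TR: "\<And>a b c. Im (\<gamma> a) < -T \<Longrightarrow> Im (\<gamma> b) > T \<Longrightarrow> \<bar>c\<bar> > R \<Longrightarrow> c * x < 0 \<Longrightarrow>
    winding_number (subpath a b \<gamma> +++ closing_path c (\<gamma> a) (\<gamma> b)) p = 0" by blast
  have "\<forall>\<^sub>F (a, b) in at_bot \<times>\<^sub>F at_top.
    winding_number (subpath a b \<gamma> +++ closing_path c (\<gamma> a) (\<gamma> b)) p = 0" if "c > \<bar>R\<bar>" for c
  proof -
    have "\<bar>c\<bar> > R" "c * x < 0" using that x(2) by (auto simp: mult_less_0_iff)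
    then show ?thesis
      using eventually_vertical_path_ends[OF \<gamma>, of T] by (auto intro: TR elim!: eventually_mono)
  qed
  then show ?thesis by blast
qed

text \<open>A connection of \<open>p\<close> to the far right may cross the line \<open>Re s = c\<close>; therefore the curve is first
  closed far to the left, where the winding number is \<open>0\<close>, and then moved over by a rectangle.\<close>

lemma lies_right_of_winding_number:
  assumes \<gamma>: "vertical_path \<gamma>" and p: "lies_right_of p \<gamma>"
    and c: "\<And>t. Re (\<gamma> t) \<le> c" "Re p < c"
  shows "\<forall>\<^sub>F (a, b) in at_bot \<times>\<^sub>F at_top.
    winding_number (subpath a b \<gamma> +++ closing_path c (\<gamma> a) (\<gamma> b)) p = -1"
proof -
  obtain L where L: "\<And>t. \<bar>Re (\<gamma> t)\<bar> \<le> L"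
    using \<gamma> by (auto simp: vertical_path_def bounded_iff)
  have "\<forall>\<^sub>F x in at_top. connected_component (- range \<gamma>) p (complex_of_real x) \<and> x > \<bar>L\<bar>"
    using p eventually_gt_at_top unfolding lies_right_of_def by (intro eventually_conj) auto
  then obtain x where x: "connected_component (- range \<gamma>) p (complex_of_real x)" "x > \<bar>L\<bar>"
    using eventually_happens'[OF trivial_limit_at_top_linorder] by blast
  then have "\<bar>x\<bar> > L" by linarith
  from winding_number_closed_vertical_eq_0[OF \<gamma> L x(1) this] obtain T R where
    TR: "\<And>a b c. Im (\<gamma> a) < -T \<Longrightarrow> Im (\<gamma> b) > T \<Longrightarrow> \<bar>c\<bar> > R \<Longrightarrow> c * x < 0 \<Longrightarrow>
    winding_number (subpath a b \<gamma> +++ closing_path c (\<gamma> a) (\<gamma> b)) p = 0" by blast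
  \<comment> \<open>Far enough left of the curve and of p for the rectangle argument, and beyond
    \<open>R\<close>, so that \<open>TR\<close> applies to the closing along Re s = l.\<close>
  define l where "l = - (1 + \<bar>R\<bar> + \<bar>L\<bar> + norm p)"
  have lz: "l < 0" unfolding l_def using norm_ge_zero[of p] by linarith
  have pn: "p \<notin> range \<gamma>"
    using connected_component_in[OF x(1)] by simp
  have wn: "winding_number (subpath a b \<gamma> +++ closing_path c (\<gamma> a) (\<gamma> b)) p = -1"
    if ab: "Im (\<gamma> a) < - (norm p + \<bar>T\<bar>)" "Im (\<gamma> b) > norm p + \<bar>T\<bar>" for a b
  proof -
    let ?s = "subpath a b \<gamma>"
    have s: "path ?s" "p \<notin> path_image ?s"
      using valid_path_imp_path[OF valid_path_subpath_vertical[OF \<gamma>]] pn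
        path_image_subpath_le_range[of a b \<gamma>] by auto
    have cl: "p \<notin> path_image (closing_path l (\<gamma> a) (\<gamma> b))"
      "p \<notin> path_image (closing_path c (\<gamma> a) (\<gamma> b))"
      using ab c abs_Re_le_cmod[of p] abs_Im_le_cmod[of p]
      by (auto simp: path_image_closing_path l_def)
    have "winding_number (?s +++ closing_path l (\<gamma> a) (\<gamma> b)) p = 0"
    proof (rule TR)
      show "\<bar>l\<bar> > R" unfolding l_def using norm_ge_zero[of p] by linarith
      show "l * x < 0" using lz x(2) by (auto simp: mult_less_0_iff)
    qed (use ab norm_ge_zero[of p] in linarith)+
    then have 1: "winding_number ?s p + winding_number (closing_path l (\<gamma> a) (\<gamma> b)) p = 0"
      using s cl by (subst (asm) winding_number_join) auto
    have "winding_number (?s +++ closing_path c (\<gamma> a) (\<gamma> b)) p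
        = winding_number ?s p + winding_number (closing_path c (\<gamma> a) (\<gamma> b)) p"
      using s cl by (intro winding_number_join) auto
    also have "winding_number (closing_path c (\<gamma> a) (\<gamma> b)) p = winding_number (closing_path l (\<gamma> a) (\<gamma> b)) p - 1"
      using ab c c(1)[of a] c(1)[of b] abs_Re_le_cmod[of p] abs_Im_le_cmod[of p] L[of a] L[of b]
      by (intro winding_number_closing_path_diff) (auto simp: l_def)
    also have "winding_number ?s p + (winding_number (closing_path l (\<gamma> a) (\<gamma> b)) p - 1) = -1"
      unfolding add_diff_eq 1 by simp
    finally show ?thesis .
  qed
  show ?thesis
    using eventually_vertical_path_ends[OF \<gamma>, of "norm p + \<bar>T\<bar>"]
    by eventually_elim (auto intro: wn)
qed

subsection \<open>The complex Barnes integral\<close>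

text \<open>Reflection is already carried out, so the denominator shows all possible poles. The
  constant factor z^\<nu> is left out and restored at the end.\<close>

definition barnes_integrand :: "complex \<Rightarrow> complex \<Rightarrow> complex \<Rightarrow> complex"
  where "barnes_integrand \<nu> x s =
    - of_real pi * x powr s * rGamma (\<nu> + 1 + s) / sin (of_real pi * s)"

text \<open>Also true at the integers, where both sides are \<open>0\<close> by convention.\<close>

lemma barnes_integrand_eq_Gamma:
  "barnes_integrand \<nu> x s = x powr s * Gamma (- s) * Gamma (1 + s) * rGamma (\<nu> + 1 + s)"
proof -
  have "Gamma (- s) * Gamma (1 + s) = - of_real pi / sin (of_real pi * s)"
    using Gamma_reflection_complex[of "-s"] by simp
  then have "x powr s * (Gamma (- s) * Gamma (1 + s)) * rGamma (\<nu> + 1 + s) = barnes_integrand \<nu> x s"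
    unfolding barnes_integrand_def by simp
  then show ?thesis by (simp only: mult.assoc)
qed

lemma sin_pi_eq_0_iff_Ints: "sin (of_real pi * s) = 0 \<longleftrightarrow> s \<in> \<int>" for s :: complex
proof
  assume "sin (of_real pi * s) = 0"
  then obtain n :: int where "of_real pi * s = of_real pi * of_int n"
    by (auto simp: sin_eq_0 mult_ac)
  then show "s \<in> \<int>" by simp
next
  assume "s \<in> \<int>"
  then obtain n where "s = of_int n" by (auto elim: Ints_cases)
  then show "sin (of_real pi * s) = 0"
    by (auto simp: sin_eq_0 mult_ac)
qed

lemma holomorphic_barnes_integrand:
  assumes "x \<noteq> 0"
  shows "barnes_integrand \<nu> x holomorphic_on - \<int>"
  unfolding barnes_integrand_def [abs_def]
  using assms by (intro holomorphic_intros) (auto simp: sin_pi_eq_0_iff_Ints)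

lemma open_Compl_Ints: "open (- \<int> :: complex set)"
  by (intro open_Compl closed_Ints)

text \<open>At a simple zero of the denominator the residue is the numerator divided by the
  derivative pi (-1)^n of the sine; this sign turns x^n into (-x)^n.\<close>

lemma residue_barnes_integrand:
  assumes "x \<noteq> 0" "Re \<nu> + 1 > 0"
  shows "residue (barnes_integrand \<nu> x) (of_nat n) = - ((- x) ^ n * rGamma (\<nu> + of_nat n + 1))"
proof -
  let ?f = "\<lambda>s. - of_real pi * x powr s * rGamma (\<nu> + 1 + s)"
  let ?g' = "of_real pi * cos (of_real pi * of_nat n) :: complex"
  \<comment> \<open>The residue formula is applied at a genuine pole: in the right half-plane
    1/Gamma has no zero, so the numerator does not vanish.\<close>
  have "Re (\<nu> + 1 + of_nat n) > 0" using assms by simp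
  then have "rGamma (\<nu> + 1 + of_nat n) \<noteq> 0"
    by (auto simp: rGamma_eq_zero_iff elim!: nonpos_Ints_cases' dest: arg_cong[of _ _ Re])
  moreover have cs: "cos (of_real pi * of_nat n) = ((-1) ^ n :: complex)"
    by (metis cos_npi cos_of_real mult.commute of_real_1 of_real_minus of_real_mult of_real_of_nat_eq of_real_power)
  ultimately have "residue (\<lambda>s. ?f s / sin (of_real pi * s)) (of_nat n) = ?f (of_nat n) / ?g'"
    using assms
    by (intro residue_simple_pole_deriv[of _ UNIV])
      (auto intro!: holomorphic_intros derivative_eq_intros simp: sin_pi_eq_0_iff_Ints)
  also have "\<dots> = - ((- x) ^ n * rGamma (\<nu> + of_nat n + 1))"
    unfolding cs using assms by (cases "even n") (auto simp: add_ac)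
  finally show ?thesis by (simp add: barnes_integrand_def [abs_def])
qed

section \<open>Bounds for the Barnes integrand\<close>

lemma norm_powr_le:
  assumes "x \<noteq> 0"
  shows "norm (x powr s) \<le> norm x powr Re s * exp (\<bar>Im s\<bar> * \<bar>Arg x\<bar>)"
proof -
  have "- Im s * Arg x \<le> \<bar>Im s\<bar> * \<bar>Arg x\<bar>"
    by (metis abs_ge_self abs_minus_cancel abs_mult)
  then show ?thesis
    unfolding norm_powr_complex by (intro mult_left_mono) auto
qed

text \<open>\<open>G\<close> is left open because two bounds on 1/Gamma are fed in: one polynomial
  in |Im s| on vertical strips, and one independent of Im s on the half-integer lines.\<close>

lemma norm_barnes_integrand_le:
  assumes "x \<noteq> 0" and "norm (rGamma (\<nu> + 1 + s)) \<le> G * exp (pi * \<bar>Im \<nu> + Im s\<bar> / 2)"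
    and "\<bar>Im s\<bar> \<ge> 1 \<or> cos (2 * (pi * Re s)) \<le> 0"
  shows "norm (barnes_integrand \<nu> x s) \<le> 4 * pi * exp (pi * \<bar>Im \<nu>\<bar> / 2) * norm x powr Re s * G
    * exp (- (pi / 2 - \<bar>Arg x\<bar>) * \<bar>Im s\<bar>)"
proof -
  have "0 \<le> G * exp (pi * \<bar>Im \<nu> + Im s\<bar> / 2)" using assms(2) norm_ge_zero order_trans by blast
  then have G: "G \<ge> 0" by (simp add: zero_le_mult_iff)
  have sn: "norm (sin (of_real pi * s)) \<ge> exp (pi * \<bar>Im s\<bar>) / 4"
  proof -
    have "\<bar>Im s\<bar> \<ge> 1 \<Longrightarrow> pi * \<bar>Im s\<bar> \<ge> 1"
      using mult_mono[of 1 pi 1 "\<bar>Im s\<bar>"] pi_ge_two by simp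
    then show ?thesis
      using norm_sin_ge[of "of_real pi * s"] assms(3) by (auto simp: abs_mult)
  qed
  have rg: "norm (rGamma (\<nu> + 1 + s)) \<le> G * exp (pi * (\<bar>Im \<nu>\<bar> + \<bar>Im s\<bar>) / 2)"
    by (rule order_trans[OF assms(2)]) (use G in \<open>auto intro!: mult_left_mono divide_right_mono\<close>)
  have "norm (barnes_integrand \<nu> x s)
      = pi * norm (x powr s) * norm (rGamma (\<nu> + 1 + s)) / norm (sin (of_real pi * s))"
    by (simp add: barnes_integrand_def norm_mult norm_divide)
  also have "\<dots> \<le> pi * (norm x powr Re s * exp (\<bar>Im s\<bar> * \<bar>Arg x\<bar>))
      * (G * exp (pi * (\<bar>Im \<nu>\<bar> + \<bar>Im s\<bar>) / 2)) / (exp (pi * \<bar>Im s\<bar>) / 4)"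
    by (intro frac_le mult_mono sn rg norm_powr_le assms) (auto intro!: mult_nonneg_nonneg G)
  also have "\<dots> = 4 * pi * norm x powr Re s * G *
      (exp (\<bar>Im s\<bar> * \<bar>Arg x\<bar>) * exp (pi * (\<bar>Im \<nu>\<bar> + \<bar>Im s\<bar>) / 2) / exp (pi * \<bar>Im s\<bar>))"
    by simp
  also have "exp (\<bar>Im s\<bar> * \<bar>Arg x\<bar>) * exp (pi * (\<bar>Im \<nu>\<bar> + \<bar>Im s\<bar>) / 2) / exp (pi * \<bar>Im s\<bar>)
      = exp (pi * \<bar>Im \<nu>\<bar> / 2) * exp (- (pi / 2 - \<bar>Arg x\<bar>) * \<bar>Im s\<bar>)"
    unfolding exp_add [symmetric] exp_diff [symmetric] by (simp add: field_simps)
  finally show ?thesis by (simp add: mult_ac)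
qed

text \<open>Makes the horizontal sides of the closing path negligible: the exponential decay beats
  the polynomial factor coming from 1/Gamma on the strip.\<close>

lemma barnes_integrand_tendsto_0_strip:
  assumes "Re x > 0" "\<epsilon> > 0"
  shows "\<exists>T. \<forall>s. \<bar>Re s\<bar> \<le> M \<longrightarrow> \<bar>Im s\<bar> \<ge> T \<longrightarrow> norm (barnes_integrand \<nu> x s) \<le> \<epsilon>"
proof -
  have x: "x \<noteq> 0" and \<delta>: "pi / 2 - \<bar>Arg x\<bar> > 0"
    using assms Arg_Re_pos[of x] by auto
  define \<delta> where "\<delta> = pi / 2 - \<bar>Arg x\<bar>"
  obtain B K where BK: "\<And>w. \<bar>Re w\<bar> \<le> M + \<bar>Re \<nu> + 1\<bar> \<Longrightarrow>
      norm (rGamma w) \<le> B * (1 + \<bar>Im w\<bar>) ^ K * exp (pi * \<bar>Im w\<bar> / 2)"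
    using norm_rGamma_strip_le by blast
  define D where "D = 4 * pi * exp (pi * \<bar>Im \<nu>\<bar> / 2) * exp (M * \<bar>ln (norm x)\<bar>) * \<bar>B\<bar>"
  have bound: "norm (barnes_integrand \<nu> x s) \<le> D * ((1 + \<bar>Im \<nu>\<bar> + \<bar>Im s\<bar>) ^ K * exp (- \<delta> * \<bar>Im s\<bar>))"
    if s: "\<bar>Re s\<bar> \<le> M" "\<bar>Im s\<bar> \<ge> 1" for s
  proof -
    let ?G = "\<bar>B\<bar> * (1 + \<bar>Im \<nu>\<bar> + \<bar>Im s\<bar>) ^ K"
    have "norm (rGamma (\<nu> + 1 + s)) \<le> B * (1 + \<bar>Im \<nu> + Im s\<bar>) ^ K * exp (pi * \<bar>Im \<nu> + Im s\<bar> / 2)"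
      using BK[of "\<nu> + 1 + s"] s by simp
    also have "\<dots> \<le> ?G * exp (pi * \<bar>Im \<nu> + Im s\<bar> / 2)"
      by (intro mult_mono power_mono) auto
    finally have "norm (barnes_integrand \<nu> x s) \<le> 4 * pi * exp (pi * \<bar>Im \<nu>\<bar> / 2) * norm x powr Re s * ?G
        * exp (- \<delta> * \<bar>Im s\<bar>)"
      unfolding \<delta>_def using s x by (intro norm_barnes_integrand_le) auto
    also have "norm x powr Re s \<le> exp (M * \<bar>ln (norm x)\<bar>)"
    proof -
      have "Re s * ln (norm x) \<le> \<bar>Re s\<bar> * \<bar>ln (norm x)\<bar>" by (metis abs_ge_self abs_mult)
      also have "\<dots> \<le> M * \<bar>ln (norm x)\<bar>" using s by (intro mult_right_mono) auto
      finally show ?thesis using x by (simp add: powr_def)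
    qed
    finally show ?thesis
      by (simp add: D_def mult_ac mult_left_mono mult_right_mono)
  qed
  have "((\<lambda>y. D * ((1 + \<bar>Im \<nu>\<bar> + y) ^ K * exp (- \<delta> * y))) \<longlongrightarrow> 0) at_top"
    using \<delta> unfolding \<delta>_def[symmetric] by real_asymp
  then have "\<forall>\<^sub>F y in at_top. D * ((1 + \<bar>Im \<nu>\<bar> + y) ^ K * exp (- \<delta> * y)) < \<epsilon>"
    using assms(2) by (rule order_tendstoD)
  then obtain T where T: "\<And>y. y \<ge> T \<Longrightarrow> D * ((1 + \<bar>Im \<nu>\<bar> + y) ^ K * exp (- \<delta> * y)) < \<epsilon>"
    by (auto simp: eventually_at_top_linorder)
  show ?thesis
  proof (intro exI allI impI)
    fix s assume "\<bar>Re s\<bar> \<le> M" "\<bar>Im s\<bar> \<ge> max 1 T"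
    then show "norm (barnes_integrand \<nu> x s) \<le> \<epsilon>"
      using bound[of s] T[of "\<bar>Im s\<bar>"] by auto
  qed
qed

text \<open>On a half-integer line cos (2 pi Re s) = -1, so the lower bound for the sine holds at
  every height. The dependence on N is collected in |x|^N / Gamma (Re \<nu> + 3/2 + N), the term of
  a convergent series.\<close>

lemma norm_barnes_integrand_half_line_le:
  assumes "x \<noteq> 0" "Re \<nu> + 1 > 0" "Re s = real N + 1/2"
  shows "norm (barnes_integrand \<nu> x s) \<le> 4 * pi * exp (pi * \<bar>Im \<nu>\<bar> / 2) * sqrt (norm x)
    * (norm x ^ N * rGamma (Re \<nu> + 3/2 + real N)) * exp (- (pi / 2 - \<bar>Arg x\<bar>) * \<bar>Im s\<bar>)"
proof -
  have "2 * (pi * Re s) = pi + real (2 * N) * pi" using assms(3) by (simp add: algebra_simps)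
  then have "cos (2 * (pi * Re s)) = -1"
    by (metis cos_periodic_pi2 cos_npi even_mult_iff even_numeral minus_one_power_iff)
  moreover have "norm (rGamma (\<nu> + 1 + s)) \<le> rGamma (Re \<nu> + 3/2 + real N) * exp (pi * \<bar>Im \<nu> + Im s\<bar> / 2)"
    using norm_rGamma_le[of "\<nu> + 1 + s"] assms by (simp add: add_ac)
  moreover have "norm x powr Re s = sqrt (norm x) * norm x ^ N"
    using assms by (simp add: powr_add powr_realpow powr_half_sqrt)
  ultimately show ?thesis
    using norm_barnes_integrand_le[of x \<nu> s "rGamma (Re \<nu> + 3/2 + real N)"] assms by (simp add: mult_ac)
qed

text \<open>The bound does not depend on the end points. The exponential is dominated by 2 / (1 +
  (\<delta> y)^2), whose antiderivative is an arctangent, so the integral need not be split at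
  0.\<close>

lemma norm_contour_integral_vertical_le:
  assumes f: "continuous_on {z. Re z = c} f"
    and bound: "\<And>s. Re s = c \<Longrightarrow> norm (f s) \<le> Q * exp (- \<delta> * \<bar>Im s\<bar>)"
    and \<delta>: "\<delta> > 0" and "A < B"
  shows "norm (contour_integral (linepath (Complex c B) (Complex c A)) f) \<le> Q * (2 * pi / \<delta>)"
proof -
  have "norm (f (Complex c 0)) \<le> Q" using bound[of "Complex c 0"] by simp
  then have Q: "Q \<ge> 0" using norm_ge_zero order_trans by blast
  let ?F = "\<lambda>y. Q * (2 / \<delta>) * arctan (\<delta> * y)"
  have int: "((\<lambda>y. Q * (2 / (1 + (\<delta> * y)\<^sup>2))) has_integral (?F B - ?F A)) {A..B}"
    using \<open>A < B\<close> \<delta>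
    by (intro fundamental_theorem_of_calculus)
      (auto intro!: derivative_eq_intros
        simp: has_real_derivative_iff_has_vector_derivative[symmetric] divide_inverse)
  have exp_le: "exp (- \<delta> * \<bar>y\<bar>) \<le> 2 / (1 + (\<delta> * y)\<^sup>2)" for y
  proof -
    have "(1 + u\<^sup>2) / 2 \<le> exp u" if "u \<ge> 0" for u :: real
      using exp_lower_Taylor_quadratic[OF that] that by simp
    from this[of "\<delta> * \<bar>y\<bar>"] have "(1 + (\<delta> * y)\<^sup>2) / 2 \<le> exp (\<delta> * \<bar>y\<bar>)"
      using \<delta> by (simp add: power_mult_distrib)
    moreover have "0 < (1 + (\<delta> * y)\<^sup>2) / 2" by (simp add: add_pos_nonneg)
    ultimately have "inverse (exp (\<delta> * \<bar>y\<bar>)) \<le> inverse ((1 + (\<delta> * y)\<^sup>2) / 2)"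
      by (rule le_imp_inverse_le)
    then show ?thesis by (simp add: exp_minus)
  qed
  have "contour_integral (linepath (Complex c B) (Complex c A)) f
      = - contour_integral (linepath (Complex c A) (Complex c B)) f"
    using contour_integral_reversepath[of "linepath (Complex c A) (Complex c B)" f] by simp
  also have "\<dots> = - (\<i> * integral {A..B} (\<lambda>y. f (Complex c y)))"
    using \<open>A < B\<close> by (subst contour_integral_linepath_same_Re) auto
  finally have "norm (contour_integral (linepath (Complex c B) (Complex c A)) f)
      = norm (integral {A..B} (\<lambda>y. f (Complex c y)))" by (simp add: norm_mult)
  also have "\<dots> \<le> integral {A..B} (\<lambda>y. Q * (2 / (1 + (\<delta> * y)\<^sup>2)))"
  proof (rule integral_norm_bound_integral)
    show "(\<lambda>y. f (Complex c y)) integrable_on {A..B}"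
      unfolding Complex_eq
      by (intro integrable_continuous_interval continuous_on_compose2[OF f] continuous_intros) auto
    show "norm (f (Complex c y)) \<le> Q * (2 / (1 + (\<delta> * y)\<^sup>2))" for y
      using bound[of "Complex c y"] mult_left_mono[OF exp_le[of y] Q] by simp
  qed (use int in blast)
  also have "\<dots> = Q * (2 / \<delta>) * (arctan (\<delta> * B) - arctan (\<delta> * A))"
    using integral_unique[OF int] by (simp add: algebra_simps)
  also have "\<dots> \<le> Q * (2 / \<delta>) * pi"
    using arctan_bounded[of "\<delta> * B"] arctan_bounded[of "\<delta> * A"] Q \<delta>
    by (intro mult_left_mono) auto
  finally show ?thesis by (simp add: mult_ac)
qed

section \<open>Closing the contour and passing to the limit\<close>

lemma barnes_path_range_Ints:
  assumes "barnes_path \<gamma>"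
  shows "range \<gamma> \<inter> \<int> = {}"
proof -
  have "of_int k \<notin> range \<gamma>" for k :: int
  proof (cases "k \<ge> 0")
    case True
    have "lies_right_of (of_nat (nat k)) \<gamma>" using assms unfolding barnes_path_def by blast
    then obtain x where "connected_component (- range \<gamma>) (of_nat (nat k)) (complex_of_real x)"
      unfolding lies_right_of_def using eventually_happens'[OF trivial_limit_at_top_linorder] by blast
    from connected_component_in[OF this] True show ?thesis by simp
  next
    case False
    then have "nat (- k) \<ge> 1" by simp
    then have "lies_left_of (- of_nat (nat (- k))) \<gamma>" using assms unfolding barnes_path_def by blast
    then obtain x where "connected_component (- range \<gamma>) (- of_nat (nat (- k))) (complex_of_real x)"
      unfolding lies_left_of_def using eventually_happens'[OF trivial_limit_at_bot_linorder] by blast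
    from connected_component_in[OF this] False show ?thesis by simp
  qed
  then show ?thesis by (auto elim!: Ints_cases)
qed

text \<open>Residue theorem in a convex strip that contains only finitely many integers. The winding
  number -1 cancels the minus sign of the residues, which leaves the partial sum with a plus
  sign.\<close>

lemma contour_integral_closed_barnes:
  fixes M N :: nat
  assumes x: "x \<noteq> 0" "Re \<nu> + 1 > 0"
    and g: "valid_path g" "pathfinish g = pathstart g"
      "path_image g \<subseteq> {s. - real (M + 1) < Re s \<and> Re s < real (N + 1)} - \<int>"
    and left: "\<And>m. m \<in> {1..M} \<Longrightarrow> winding_number g (- of_nat m) = 0"
    and right: "\<And>n. n \<in> {..N} \<Longrightarrow> winding_number g (of_nat n) = -1"
  shows "contour_integral g (barnes_integrand \<nu> x)
    = 2 * of_real pi * \<i> * (\<Sum>n\<le>N. (- x) ^ n * rGamma (\<nu> + of_nat n + 1))"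
proof -
  let ?S = "{s. - real (M + 1) < Re s \<and> Re s < real (N + 1)}"
  let ?f = "barnes_integrand \<nu> x"
  let ?A = "of_nat ` {..N} :: complex set" and ?B = "(\<lambda>m. - of_nat m) ` {1..M} :: complex set"
  have S: "?S = {s. Re s > - real (M + 1)} \<inter> {s. Re s < real (N + 1)}" by auto
  have conv: "convex ?S" unfolding S by (intro convex_Int convex_halfspace_Re_gt convex_halfspace_Re_lt)
  have op: "open ?S" unfolding S by (intro open_Int open_halfspace_Re_gt open_halfspace_Re_lt)
  have ints: "s \<in> ?A \<union> ?B" if s: "s \<in> ?S" "s \<in> \<int>" for s
  proof -
    from s(2) obtain k where k: "s = of_int k" by (auto elim: Ints_cases)
    with s have "- int (M + 1) < k" "k < int (N + 1)" by auto
    then show ?thesis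
    proof (cases "k \<ge> 0")
      case True
      then have "s = of_nat (nat k)" "nat k \<le> N" using \<open>k < int (N + 1)\<close> by (auto simp: k)
      then show ?thesis by blast
    next
      case False
      then have "s = - of_nat (nat (- k))" "nat (- k) \<in> {1..M}"
        using \<open>- int (M + 1) < k\<close> by (auto simp: k)
      then show ?thesis by blast
    qed
  qed
  have AB: "?A \<subseteq> \<int>" "?B \<subseteq> \<int>" by auto
  have "contour_integral g ?f = 2 * pi * \<i> * (\<Sum>p\<in>?A \<union> ?B. winding_number g p * residue ?f p)"
  proof (rule Residue_theorem[OF op convex_connected[OF conv] _ _ g(1,2)])
    show "?f holomorphic_on ?S - (?A \<union> ?B)"
      by (rule holomorphic_on_subset[OF holomorphic_barnes_integrand[OF x(1)]]) (use ints in blast)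
    show "path_image g \<subseteq> ?S - (?A \<union> ?B)" using g(3) AB by blast
    show "\<forall>z. z \<notin> ?S \<longrightarrow> winding_number g z = 0"
      using winding_number_zero_outside[OF valid_path_imp_path[OF g(1)] conv g(2)] g(3) by blast
  qed auto
  also have "(\<Sum>p\<in>?A \<union> ?B. winding_number g p * residue ?f p)
      = (\<Sum>p\<in>?A. winding_number g p * residue ?f p) + (\<Sum>p\<in>?B. winding_number g p * residue ?f p)"
    by (intro sum.union_disjoint) (auto dest: arg_cong[of _ _ Re])
  also have "(\<Sum>p\<in>?B. winding_number g p * residue ?f p) = 0"
    using left by (intro sum.neutral) auto
  also have "(\<Sum>p\<in>?A. winding_number g p * residue ?f p)
      = (\<Sum>n\<le>N. (- x) ^ n * rGamma (\<nu> + of_nat n + 1))"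
    using right x by (subst sum.reindex) (auto simp: inj_on_def residue_barnes_integrand intro!: sum.cong)
  finally show ?thesis by simp
qed

text \<open>N is fixed while the ends of the curve run off. The horizontal sides then contribute at
  most \<epsilon>, whereas the vertical side keeps a bound that becomes small only with N. Negative
  integers below -L lie outside the closed curve, hence the restriction to m <= L.\<close>

lemma barnes_contour_integral_near_partial_sum:
  fixes N :: nat
  assumes x: "Re x > 0" "Re \<nu> + 1 > 0" and bp: "barnes_path \<gamma>"
    and L: "\<And>t. \<bar>Re (\<gamma> t)\<bar> \<le> L" "L \<le> real N"
    and left: "\<And>m. 1 \<le> m \<Longrightarrow> real m \<le> L \<Longrightarrow>
      \<forall>\<^sub>F (a, b) in at_bot \<times>\<^sub>F at_top.
        winding_number (subpath a b \<gamma> +++ closing_path (real N + 1/2) (\<gamma> a) (\<gamma> b)) (- of_nat m) = 0"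
    and "\<epsilon> > 0"
  shows "\<forall>\<^sub>F (a, b) in at_bot \<times>\<^sub>F at_top.
    norm (contour_integral (subpath a b \<gamma>) (barnes_integrand \<nu> x)
      - 2 * of_real pi * \<i> * (\<Sum>n\<le>N. (- x) ^ n * rGamma (\<nu> + of_nat n + 1)))
    \<le> 4 * pi * exp (pi * \<bar>Im \<nu>\<bar> / 2) * sqrt (norm x)
        * (norm x ^ N * rGamma (Re \<nu> + 3/2 + real N)) * (2 * pi / (pi / 2 - \<bar>Arg x\<bar>)) + \<epsilon>"
proof -
  let ?f = "barnes_integrand \<nu> x"
  define c where "c = real N + 1/2"
  define M where "M = nat \<lfloor>L\<rfloor>"
  have \<gamma>: "vertical_path \<gamma>" using bp by (simp add: barnes_path_def)
  have x0: "x \<noteq> 0" and \<delta>: "pi / 2 - \<bar>Arg x\<bar> > 0"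
    using x Arg_Re_pos[of x] by auto
  have L0: "L \<ge> 0" using L(1)[of 0] by linarith
  have M: "real M \<le> L" "L < real (M + 1)" using L0 unfolding M_def by linarith+
  have "M \<le> N" using M L by linarith
  \<comment> \<open>Each horizontal side has length at most c + L, so this pointwise bound gives
    \<epsilon> / 2 per side.\<close>
  define \<eta> where "\<eta> = \<epsilon> / 2 / (c + L)"
  have cL: "c + L > 0" using L0 by (simp add: c_def)
  then have \<eta>: "\<eta> * (c + L) = \<epsilon> / 2"
    using \<eta>_def by (metis less_irrefl nonzero_eq_divide_eq)
  have "\<eta> > 0" using cL \<open>\<epsilon> > 0\<close> by (simp add: \<eta>_def)
  from barnes_integrand_tendsto_0_strip[OF x(1) this, of "c + L" \<nu>] obtain T where
    T: "\<And>s. \<bar>Re s\<bar> \<le> c + L \<Longrightarrow> \<bar>Im s\<bar> \<ge> T \<Longrightarrow> norm (?f s) \<le> \<eta>" by blast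
  have "\<forall>\<^sub>F ab in at_bot \<times>\<^sub>F at_top. \<forall>m\<in>{1..M}.
      winding_number (subpath (fst ab) (snd ab) \<gamma> +++ closing_path c (\<gamma> (fst ab)) (\<gamma> (snd ab))) (- of_nat m) = 0"
    using left \<open>M \<le> N\<close> M unfolding c_def
    by (intro eventually_ball_finite) (auto simp: case_prod_unfold)
  moreover have "\<forall>\<^sub>F ab in at_bot \<times>\<^sub>F at_top. \<forall>n\<in>{..N}.
      winding_number (subpath (fst ab) (snd ab) \<gamma> +++ closing_path c (\<gamma> (fst ab)) (\<gamma> (snd ab))) (of_nat n) = -1"
  proof (intro eventually_ball_finite ballI)
    fix n assume n: "n \<in> {..N}"
    have "Re (\<gamma> t) \<le> c" for t using L(1)[of t] L(2) by (simp add: c_def)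
    then show "\<forall>\<^sub>F ab in at_bot \<times>\<^sub>F at_top.
      winding_number (subpath (fst ab) (snd ab) \<gamma> +++ closing_path c (\<gamma> (fst ab)) (\<gamma> (snd ab))) (of_nat n) = -1"
      using lies_right_of_winding_number[OF \<gamma>, of "of_nat n" c] bp n
      by (simp add: barnes_path_def case_prod_unfold c_def)
  qed auto
  moreover have "\<forall>\<^sub>F ab in at_bot \<times>\<^sub>F at_top. Im (\<gamma> (fst ab)) < - \<bar>T\<bar> \<and> Im (\<gamma> (snd ab)) > \<bar>T\<bar>"
    using eventually_vertical_path_ends[OF \<gamma>, of "\<bar>T\<bar>"] by (simp add: case_prod_unfold)
  ultimately show ?thesis
    unfolding case_prod_unfold
  proof eventually_elim
    case (elim ab)
    define a b where "a = fst ab" and "b = snd ab"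
    have left: "\<And>m. m \<in> {1..M} \<Longrightarrow> winding_number (subpath a b \<gamma> +++ closing_path c (\<gamma> a) (\<gamma> b)) (- of_nat m) = 0"
      and right: "\<And>n. n \<in> {..N} \<Longrightarrow> winding_number (subpath a b \<gamma> +++ closing_path c (\<gamma> a) (\<gamma> b)) (of_nat n) = -1"
      and Im: "Im (\<gamma> a) < - \<bar>T\<bar>" "Im (\<gamma> b) > \<bar>T\<bar>"
      using elim by (auto simp: a_def b_def)
    define h1 v h2 where "h1 = linepath (\<gamma> b) (Complex c (Im (\<gamma> b)))"
      and "v = linepath (Complex c (Im (\<gamma> b))) (Complex c (Im (\<gamma> a)))"
      and "h2 = linepath (Complex c (Im (\<gamma> a))) (\<gamma> a)"
    note hv_defs = h1_def v_def h2_def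
    have cp: "closing_path c (\<gamma> a) (\<gamma> b) = h1 +++ v +++ h2" by (simp add: closing_path_def hv_defs)
    \<comment> \<open>A half-integer line misses the integers, by parity.\<close>
    have cI: "\<not> (Re z = c \<and> z \<in> \<int>)" for z
    proof
      assume "Re z = c \<and> z \<in> \<int>"
      then obtain k :: int where "real_of_int k = real N + 1/2"
        by (auto simp: c_def elim!: Ints_cases)
      then have "real_of_int (2 * k) = real_of_int (2 * int N + 1)" by simp
      then have "2 * k = 2 * int N + 1" unfolding of_int_eq_iff .
      then show False by presburger
    qed
    have IntsD: "Im z = 0" if "z \<in> \<int>" for z :: complex
      using that by (auto elim: Ints_cases)
    have Re_bounds: "- L \<le> Re (\<gamma> a)" "Re (\<gamma> a) \<le> c" "- L \<le> Re (\<gamma> b)" "Re (\<gamma> b) \<le> c" "L < c"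
      using L(1)[of a] L(1)[of b] L(2) by (auto simp: c_def)
    have subp: "path_image (subpath a b \<gamma>) \<subseteq> {s. - real (M + 1) < Re s \<and> Re s < real (N + 1)} - \<int>"
    proof -
      have "\<gamma> t \<in> {s. - real (M + 1) < Re s \<and> Re s < real (N + 1)} - \<int>" for t
        using L(1)[of t] L(2) M barnes_path_range_Ints[OF bp] by auto
      then show ?thesis using path_image_subpath_le_range[of a b \<gamma>] by blast
    qed
    have clp: "path_image (closing_path c (\<gamma> a) (\<gamma> b)) \<subseteq> {s. - real (M + 1) < Re s \<and> Re s < real (N + 1)} - \<int>"
    proof
      fix z assume z: "z \<in> path_image (closing_path c (\<gamma> a) (\<gamma> b))"
      then have "Re z = c \<or> Im z \<noteq> 0" using Im by (auto simp: path_image_closing_path)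
      moreover have "- L \<le> Re z \<and> Re z \<le> c"
        using z Re_bounds L0 by (auto simp: path_image_closing_path closed_segment_eq_real_ivl)
      ultimately show "z \<in> {s. - real (M + 1) < Re s \<and> Re s < real (N + 1)} - \<int>"
        using cI IntsD M by (auto simp: c_def)
    qed
    have img: "path_image (closing_path c (\<gamma> a) (\<gamma> b)) = path_image h1 \<union> path_image v \<union> path_image h2"
      by (auto simp: cp path_image_join hv_defs)
    have integrable: "?f contour_integrable_on subpath a b \<gamma>" "?f contour_integrable_on h1"
      "?f contour_integrable_on v" "?f contour_integrable_on h2"
      using subp clp img
      by (intro contour_integrable_holomorphic_simple[OF holomorphic_barnes_integrand[OF x0] open_Compl_Ints]
          valid_path_subpath_vertical[OF \<gamma>]; auto simp: hv_defs)+
    have valid: "valid_path (subpath a b \<gamma>)" "valid_path h1" "valid_path v" "valid_path h2"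
      by (auto simp: hv_defs valid_path_subpath_vertical[OF \<gamma>])
    have "contour_integral (subpath a b \<gamma> +++ h1 +++ v +++ h2) ?f =
      contour_integral (subpath a b \<gamma>) ?f + (contour_integral h1 ?f + (contour_integral v ?f + contour_integral h2 ?f))"
    proof -
      have "valid_path (v +++ h2)" "valid_path (h1 +++ v +++ h2)"
        by (auto simp: hv_defs)
      moreover have "?f contour_integrable_on (v +++ h2)"
        using integrable valid by (intro contour_integrable_joinI) auto
      moreover from this have "?f contour_integrable_on (h1 +++ v +++ h2)"
        using integrable valid by (intro contour_integrable_joinI) (auto simp: hv_defs)
      ultimately show ?thesis using integrable valid by (simp add: contour_integral_join)
    qed
    moreover have "contour_integral (subpath a b \<gamma> +++ h1 +++ v +++ h2) ?f
        = 2 * of_real pi * \<i> * (\<Sum>n\<le>N. (- x) ^ n * rGamma (\<nu> + of_nat n + 1))"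
      unfolding cp[symmetric]
    proof (rule contour_integral_closed_barnes[OF x0 x(2), of _ M])
      show "path_image (subpath a b \<gamma> +++ closing_path c (\<gamma> a) (\<gamma> b))
        \<subseteq> {s. - real (M + 1) < Re s \<and> Re s < real (N + 1)} - \<int>"
        using subp clp by (intro subset_path_image_join)
    qed (use left right valid in \<open>auto intro!: valid_path_join\<close>)
    ultimately have eq: "contour_integral (subpath a b \<gamma>) ?f
        - 2 * of_real pi * \<i> * (\<Sum>n\<le>N. (- x) ^ n * rGamma (\<nu> + of_nat n + 1))
        = - (contour_integral v ?f + (contour_integral h1 ?f + contour_integral h2 ?f))"
      by (simp add: algebra_simps)
    have "norm (contour_integral v ?f) \<le> 4 * pi * exp (pi * \<bar>Im \<nu>\<bar> / 2) * sqrt (norm x)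
        * (norm x ^ N * rGamma (Re \<nu> + 3/2 + real N)) * (2 * pi / (pi / 2 - \<bar>Arg x\<bar>))"
      unfolding v_def
    proof (rule norm_contour_integral_vertical_le)
      show "continuous_on {z. Re z = c} ?f"
        by (rule holomorphic_on_imp_continuous_on, rule holomorphic_on_subset[OF holomorphic_barnes_integrand[OF x0]])
          (use cI in blast)
      show "Im (\<gamma> a) < Im (\<gamma> b)" using Im by linarith
    qed (use norm_barnes_integrand_half_line_le[OF x0 x(2)] \<delta> in \<open>auto simp: c_def\<close>)
    moreover have "norm (contour_integral h1 ?f) \<le> \<epsilon> / 2" "norm (contour_integral h2 ?f) \<le> \<epsilon> / 2"
    proof -
      have "norm (contour_integral h1 ?f) \<le> \<eta> * norm (Complex c (Im (\<gamma> b)) - \<gamma> b)"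
        using has_contour_integral_integral[OF integrable(2)] unfolding h1_def
      proof (rule has_contour_integral_bound_linepath)
        fix s assume "s \<in> closed_segment (\<gamma> b) (Complex c (Im (\<gamma> b)))"
        then show "norm (?f s) \<le> \<eta>"
          using Im Re_bounds L0 by (intro T) (auto simp: closed_segment_same_Im closed_segment_eq_real_ivl split: if_splits)
      qed (use \<open>\<eta> > 0\<close> in simp)
      also have "\<dots> \<le> \<eta> * (c + L)"
        using Re_bounds \<open>\<eta> > 0\<close> by (intro mult_left_mono) (auto simp: cmod_def)
      finally show "norm (contour_integral h1 ?f) \<le> \<epsilon> / 2"
        by (simp only: \<eta>)
      have "norm (contour_integral h2 ?f) \<le> \<eta> * norm (\<gamma> a - Complex c (Im (\<gamma> a)))"
        using has_contour_integral_integral[OF integrable(4)] unfolding h2_def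
      proof (rule has_contour_integral_bound_linepath)
        fix s assume "s \<in> closed_segment (Complex c (Im (\<gamma> a))) (\<gamma> a)"
        then show "norm (?f s) \<le> \<eta>"
          using Im Re_bounds L0 by (intro T) (auto simp: closed_segment_same_Im closed_segment_eq_real_ivl split: if_splits)
      qed (use \<open>\<eta> > 0\<close> in simp)
      also have "\<dots> \<le> \<eta> * (c + L)"
        using Re_bounds \<open>\<eta> > 0\<close> by (intro mult_left_mono) (auto simp: cmod_def)
      finally show "norm (contour_integral h2 ?f) \<le> \<epsilon> / 2"
        by (simp only: \<eta>)
    qed
    ultimately show ?case
      unfolding a_def[symmetric] b_def[symmetric] eq norm_minus_cancel
      using norm_triangle_ineq[of "contour_integral v ?f" "contour_integral h1 ?f + contour_integral h2 ?f"]
        norm_triangle_ineq[of "contour_integral h1 ?f" "contour_integral h2 ?f"]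
      by linarith
  qed
qed

text \<open>First N is chosen so that the vertical side and the tail of the series are each below e
  / 3, then the ends of the curve are taken far enough out for the horizontal sides.\<close>

lemma barnes_integral:
  assumes x: "Re x > 0" "Re \<nu> + 1 > 0" and bp: "barnes_path \<gamma>"
  shows "has_improper_contour_integral
    (\<lambda>s. x powr s * Gamma (- s) * Gamma (1 + s) * rGamma (\<nu> + 1 + s))
    (2 * of_real pi * \<i> * (\<Sum>n. (- x) ^ n * rGamma (\<nu> + of_nat n + 1))) \<gamma>"
  unfolding has_improper_contour_integral_def barnes_integrand_eq_Gamma [symmetric]
proof (intro conjI allI)
  let ?f = "barnes_integrand \<nu> x"
  let ?t = "\<lambda>n. (- x) ^ n * rGamma (\<nu> + of_nat n + 1)"
  have \<gamma>: "vertical_path \<gamma>" using bp by (simp add: barnes_path_def)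
  have x0: "x \<noteq> 0" using x by auto
  show "(\<lambda>s. ?f s) contour_integrable_on subpath a b \<gamma>" for a b
    using path_image_subpath_le_range[of a b \<gamma>] barnes_path_range_Ints[OF bp]
    by (intro contour_integrable_holomorphic_simple[OF holomorphic_barnes_integrand[OF x0] open_Compl_Ints]
          valid_path_subpath_vertical[OF \<gamma>]) auto
  obtain L where L: "\<And>t. \<bar>Re (\<gamma> t)\<bar> \<le> L"
    using \<gamma> by (auto simp: vertical_path_def bounded_iff)
  let ?G = "at_bot \<times>\<^sub>F at_top :: (real \<times> real) filter"
  let ?W = "\<lambda>c m. \<forall>\<^sub>F (a, b) in ?G.
    winding_number (subpath a b \<gamma> +++ closing_path c (\<gamma> a) (\<gamma> b)) (- of_nat m) = 0"
  \<comment> \<open>Each -m has its own threshold for the closing line; only finitely many m are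
    relevant, so all large N work for them together.\<close>
  have "\<forall>m\<in>{1..nat \<lceil>L\<rceil>}. \<forall>\<^sub>F c in at_top. ?W c m"
  proof
    fix m assume "m \<in> {1..nat \<lceil>L\<rceil>}"
    then have "lies_left_of (- of_nat m) \<gamma>" using bp by (simp add: barnes_path_def)
    from lies_left_of_winding_number[OF \<gamma> this] show "\<forall>\<^sub>F c in at_top. ?W c m"
      by (auto simp: eventually_at_top_dense)
  qed
  then have "\<forall>\<^sub>F c in at_top. \<forall>m\<in>{1..nat \<lceil>L\<rceil>}. ?W c m"
    by (intro eventually_ball_finite) auto
  then have leftN: "\<forall>\<^sub>F N in sequentially. \<forall>m\<in>{1..nat \<lceil>L\<rceil>}. ?W (real N + 1/2) m"
    by (rule eventually_compose_filterlim) real_asymp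
  let ?K = "4 * pi * exp (pi * \<bar>Im \<nu>\<bar> / 2) * sqrt (norm x)"
  let ?Q = "\<lambda>N. ?K * (norm x ^ N * rGamma (Re \<nu> + 3/2 + real N)) * (2 * pi / (pi / 2 - \<bar>Arg x\<bar>))"
  \<comment> \<open>The complex summability result is used at a real argument; positivity of 1/Gamma
    there removes the norm again.\<close>
  have "(\<lambda>N. norm (of_real (norm x) ^ N * rGamma (of_real (Re \<nu> + 3/2) + of_nat N) :: complex)) \<longlonglongrightarrow> 0"
    by (intro summable_LIMSEQ_zero summable_norm_power_rGamma)
  also have "(\<lambda>N. norm (of_real (norm x) ^ N * rGamma (of_real (Re \<nu> + 3/2) + of_nat N) :: complex))
      = (\<lambda>N. norm x ^ N * rGamma (Re \<nu> + 3/2 + real N))"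
  proof
    fix N
    have "rGamma (Re \<nu> + 3/2 + real N) > 0" using x by (intro rGamma_real_pos) linarith
    moreover have "of_real (norm x) ^ N * rGamma (of_real (Re \<nu> + 3/2) + of_nat N)
        = complex_of_real (norm x ^ N * rGamma (Re \<nu> + 3/2 + real N))"
      by (simp flip: rGamma_complex_of_real)
    ultimately show "norm (of_real (norm x) ^ N * rGamma (of_real (Re \<nu> + 3/2) + of_nat N) :: complex)
      = norm x ^ N * rGamma (Re \<nu> + 3/2 + real N)"
      by (simp only: norm_of_real) (simp add: abs_mult)
  qed
  finally have "(\<lambda>N. norm x ^ N * rGamma (Re \<nu> + 3/2 + real N)) \<longlonglongrightarrow> 0" .
  then have Q: "?Q \<longlonglongrightarrow> 0"
    by (intro tendsto_mult_left_zero tendsto_mult_right_zero)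
  have "summable ?t"
    using summable_norm_cancel[OF summable_norm_power_rGamma[of "- x" "\<nu> + 1"]] by (simp add: add_ac)
  then have "(\<lambda>N. \<Sum>n\<le>N. ?t n) \<longlonglongrightarrow> (\<Sum>n. ?t n)"
    by (rule summable_LIMSEQ')
  then have S: "(\<lambda>N. 2 * of_real pi * \<i> * (\<Sum>n\<le>N. ?t n)) \<longlonglongrightarrow> 2 * of_real pi * \<i> * (\<Sum>n. ?t n)"
    by (intro tendsto_intros)
  show "((\<lambda>(a, b). contour_integral (subpath a b \<gamma>) (\<lambda>s. ?f s)) \<longlongrightarrow> 2 * of_real pi * \<i> * (\<Sum>n. ?t n)) ?G"
  proof (rule tendstoI)
    fix e :: real assume "e > 0"
    then have e: "e / 3 > 0" by simp
    have "\<forall>\<^sub>F N in sequentially. real N \<ge> L" by real_asymp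
    with order_tendstoD(2)[OF Q e] tendstoD[OF S e] leftN
    have "\<forall>\<^sub>F N in sequentially. ?Q N < e / 3 \<and>
      dist (2 * of_real pi * \<i> * (\<Sum>n\<le>N. ?t n)) (2 * of_real pi * \<i> * (\<Sum>n. ?t n)) < e / 3 \<and>
      (\<forall>m\<in>{1..nat \<lceil>L\<rceil>}. ?W (real N + 1/2) m) \<and> real N \<ge> L"
      by eventually_elim auto
    then obtain N where N: "?Q N < e / 3"
      "dist (2 * of_real pi * \<i> * (\<Sum>n\<le>N. ?t n)) (2 * of_real pi * \<i> * (\<Sum>n. ?t n)) < e / 3"
      "\<And>m. m \<in> {1..nat \<lceil>L\<rceil>} \<Longrightarrow> ?W (real N + 1/2) m" "L \<le> real N"
      using eventually_happens'[OF trivial_limit_sequentially] by blast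
    have "\<forall>\<^sub>F (a, b) in ?G. norm (contour_integral (subpath a b \<gamma>) ?f - 2 * of_real pi * \<i> * (\<Sum>n\<le>N. ?t n))
      \<le> ?Q N + e / 3"
    proof (rule barnes_contour_integral_near_partial_sum[OF x bp L N(4) _ e])
      fix m :: nat assume "1 \<le> m" "real m \<le> L"
      then show "?W (real N + 1/2) m" by (intro N(3)) (auto, linarith)
    qed
    then show "\<forall>\<^sub>F ab in ?G. dist (case ab of (a, b) \<Rightarrow> contour_integral (subpath a b \<gamma>) (\<lambda>s. ?f s))
        (2 * of_real pi * \<i> * (\<Sum>n. ?t n)) < e"
    proof eventually_elim
      case (elim ab)
      obtain a b where ab: "ab = (a, b)" by (cases ab)
      let ?I = "contour_integral (subpath a b \<gamma>) ?f" and ?s = "2 * of_real pi * \<i> * (\<Sum>n\<le>N. ?t n)"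
      have "dist ?I ?s \<le> ?Q N + e / 3" using elim by (simp add: ab dist_norm)
      with N(1,2) dist_triangle[of ?I "2 * of_real pi * \<i> * (\<Sum>n. ?t n)" ?s]
      show ?case unfolding ab prod.case by linarith
    qed
  qed
qed

subsection \<open>Idempotent components\<close>

lemma has_improper_contour_integral_cmult:
  assumes "has_improper_contour_integral f I \<gamma>"
  shows "has_improper_contour_integral (\<lambda>s. k * f s) (k * I) \<gamma>"
proof -
  have f: "f contour_integrable_on subpath a b \<gamma>" for a b
    using assms by (auto simp: has_improper_contour_integral_def)
  have lim: "((\<lambda>(a, b). contour_integral (subpath a b \<gamma>) f) \<longlongrightarrow> I) (at_bot \<times>\<^sub>F at_top)"
    using assms by (auto simp: has_improper_contour_integral_def)
  show ?thesis
    using tendsto_mult_left[OF lim, of k] f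
    by (simp add: has_improper_contour_integral_def contour_integrable_lmul contour_integral_lmul
        case_prod_unfold)
qed

text \<open>The topology of \<open>bicomplex\<close> comes from the pair of coordinates w1, w2, and
  these are linear in the idempotent components, so limits can be taken in the product type.\<close>

lemma tendsto_bc_of_idem:
  assumes "(f \<longlongrightarrow> a) F" "(g \<longlongrightarrow> b) F"
  shows "((\<lambda>x. bc_of_idem (f x) (g x)) \<longlongrightarrow> bc_of_idem a b) F"
proof -
  have "bc_of_idem u v = BC ((u + v) / 2) (\<i> * (u - v) / 2)" for u v
    by (simp add: bc_defs complex_eq_iff field_simps)
  then have dist: "dist (bc_of_idem u v) (bc_of_idem u' v')
      = dist ((u + v) / 2, \<i> * (u - v) / 2) ((u' + v') / 2, \<i> * (u' - v') / 2)" for u v u' v'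
    by (simp add: dist_bicomplex_def norm_bicomplex_def minus_bicomplex_def dist_norm)
  have "((\<lambda>x. ((f x + g x) / 2, \<i> * (f x - g x) / 2)) \<longlongrightarrow> ((a + b) / 2, \<i> * (a - b) / 2)) F"
    using assms by (intro tendsto_intros) auto
  then show ?thesis
    unfolding tendsto_iff dist .
qed

lemma idem_simps [simp]:
  "idem1 0 = 0" "idem2 0 = 0" "idem1 1 = 1" "idem2 1 = 1"
  "idem1 (- Z) = - idem1 Z" "idem2 (- Z) = - idem2 Z"
  "idem1 (bc_of_complex z) = z" "idem2 (bc_of_complex z) = z"
  by (simp_all add: bc_defs)

lemma idem_power: "idem1 (Z ^ n) = idem1 Z ^ n" "idem2 (Z ^ n) = idem2 Z ^ n"
  by (induction n) (simp_all add: idem_mult)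

lemma idem_of_nat [simp]: "idem1 (of_nat n) = of_nat n" "idem2 (of_nat n) = of_nat n"
  by (induction n) (simp_all add: idem_add)

lemma idem_sum: "idem1 (sum f A) = (\<Sum>x\<in>A. idem1 (f x))" "idem2 (sum f A) = (\<Sum>x\<in>A. idem2 (f x))"
  by (induction A rule: infinite_finite_induct) (simp_all add: idem_add)

lemma sums_bc_of_idem:
  assumes "(\<lambda>n. idem1 (f n)) sums a" "(\<lambda>n. idem2 (f n)) sums b"
  shows "f sums bc_of_idem a b"
proof -
  have "(\<lambda>n. bc_of_idem (\<Sum>i<n. idem1 (f i)) (\<Sum>i<n. idem2 (f i))) \<longlonglongrightarrow> bc_of_idem a b"
    using assms by (intro tendsto_bc_of_idem) (auto simp: sums_def)
  then show ?thesis
    by (simp add: sums_def flip: idem_sum)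
qed

text \<open>The series in \<open>miller_ross\<close> is a bicomplex limit; it splits into two
  complex series because both of these converge.\<close>

lemma idem_miller_ross:
  "idem1 (miller_ross V C Z) = idem1 Z powr idem1 V *
    (\<Sum>n. (idem1 C * idem1 Z) ^ n * rGamma (idem1 V + of_nat n + 1))"
  "idem2 (miller_ross V C Z) = idem2 Z powr idem2 V *
    (\<Sum>n. (idem2 C * idem2 Z) ^ n * rGamma (idem2 V + of_nat n + 1))"
proof -
  let ?f = "\<lambda>r. (C * Z) ^ r * bc_rGamma (V + of_nat r + 1)"
  have s: "summable (\<lambda>n. x ^ n * rGamma (\<nu> + of_nat n + 1))" for x \<nu> :: complex
    using summable_norm_cancel[OF summable_norm_power_rGamma[of x "\<nu> + 1"]] by (simp add: add_ac)
  have "?f sums bc_of_idem (\<Sum>n. (idem1 C * idem1 Z) ^ n * rGamma (idem1 V + of_nat n + 1))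
      (\<Sum>n. (idem2 C * idem2 Z) ^ n * rGamma (idem2 V + of_nat n + 1))"
    by (rule sums_bc_of_idem)
      (simp_all add: idem_mult idem_power idem_add bc_rGamma_def summable_sums[OF s])
  from sums_unique[OF this, symmetric]
  show "idem1 (miller_ross V C Z) = idem1 Z powr idem1 V *
    (\<Sum>n. (idem1 C * idem1 Z) ^ n * rGamma (idem1 V + of_nat n + 1))"
  "idem2 (miller_ross V C Z) = idem2 Z powr idem2 V *
    (\<Sum>n. (idem2 C * idem2 Z) ^ n * rGamma (idem2 V + of_nat n + 1))"
    by (simp_all add: miller_ross_def idem_mult bc_powr_def)
qed

theorem theorem3p4:
  fixes Z V C :: bicomplex
    and z1 z2 c1 c2 \<nu>1 \<nu>2 \<alpha> \<beta> :: complex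
    and \<Omega> :: "real \<Rightarrow> bicomplex"
  assumes Z: "Z = bc_of_complex z1 * bc_e1 + bc_of_complex z2 * bc_e2"
    and V_idem: "V = bc_of_complex \<nu>1 * bc_e1 + bc_of_complex \<nu>2 * bc_e2"
    and V: "V = bc_of_complex \<alpha> + bc_j * bc_of_complex \<beta>"
    and C: "C = bc_of_complex c1 * bc_e1 + bc_of_complex c2 * bc_e2"
    and "Re \<alpha> + 1 > \<bar>Im \<beta>\<bar>"
    and "Re (c1 * z1) < 0"
    and "Re (c2 * z2) < 0"
    and "barnes_path (\<lambda>t. idem1 (\<Omega> t))"
    and "barnes_path (\<lambda>t. idem2 (\<Omega> t))"
  shows "has_bc_contour_integral
    (\<lambda>s. Z bc_powr V * (- (C * Z)) bc_powr s * bc_Gamma (- s) * bc_Gamma (1 + s)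
          * bc_rGamma (V + 1 + s))
    (bc_of_complex (2 * of_real pi * \<i>) * miller_ross V C Z) \<Omega>"
proof -
  have idem: "idem1 Z = z1" "idem2 Z = z2" "idem1 V = \<nu>1" "idem2 V = \<nu>2" "idem1 C = c1" "idem2 C = c2"
    unfolding Z V_idem C bc_of_idem_def [symmetric] by simp_all
  have "idem1 V = \<alpha> - \<i> * \<beta>" "idem2 V = \<alpha> + \<i> * \<beta>"
    unfolding V by (simp_all add: bc_defs)
  then have \<nu>: "\<nu>1 = \<alpha> - \<i> * \<beta>" "\<nu>2 = \<alpha> + \<i> * \<beta>" by (simp_all add: idem)
  \<comment> \<open>The real parts of \<nu>1 and \<nu>2 are Re \<alpha> + Im \<beta> and Re \<alpha>
    - Im \<beta>, so the hypothesis on |Im \<beta>| covers both components.\<close>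
  have Re: "Re \<nu>1 + 1 > 0" "Re \<nu>2 + 1 > 0" "Re (- (c1 * z1)) > 0" "Re (- (c2 * z2)) > 0"
    using assms(5-7) by (simp_all add: \<nu>)
  let ?f = "\<lambda>z \<nu> c s. z powr \<nu> * ((- (c * z)) powr s * Gamma (- s) * Gamma (1 + s) * rGamma (\<nu> + 1 + s))"
  \<comment> \<open>The double minus is (-x)^n with x = - c z, as \<open>barnes_integral\<close>
    delivers it.\<close>
  let ?I = "\<lambda>z \<nu> c. z powr \<nu> * (2 * of_real pi * \<i> * (\<Sum>n. (- (- (c * z))) ^ n * rGamma (\<nu> + of_nat n + 1)))"
  show ?thesis
    unfolding has_bc_contour_integral_def
  proof (intro exI conjI allI)
    show "has_improper_contour_integral (?f z1 \<nu>1 c1) (?I z1 \<nu>1 c1) (\<lambda>t. idem1 (\<Omega> t))"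
      "has_improper_contour_integral (?f z2 \<nu>2 c2) (?I z2 \<nu>2 c2) (\<lambda>t. idem2 (\<Omega> t))"
      using Re assms(8,9) by (intro has_improper_contour_integral_cmult barnes_integral; simp)+
    show "Z bc_powr V * (- (C * Z)) bc_powr bc_of_idem s1 s2 * bc_Gamma (- bc_of_idem s1 s2)
        * bc_Gamma (1 + bc_of_idem s1 s2) * bc_rGamma (V + 1 + bc_of_idem s1 s2)
      = bc_of_idem (?f z1 \<nu>1 c1 s1) (?f z2 \<nu>2 c2 s2)" for s1 s2
      by (simp add: bc_eq_idem_iff idem_mult idem_add bc_powr_def bc_Gamma_def bc_rGamma_def idem mult.assoc)
    show "bc_of_complex (2 * of_real pi * \<i>) * miller_ross V C Z = bc_of_idem (?I z1 \<nu>1 c1) (?I z2 \<nu>2 c2)"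
      by (simp add: bc_eq_idem_iff idem_mult idem_miller_ross idem)
  qed
qed

end
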